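(* Let $\mu$ be a finite positive Borel measure on $\mathbb{D}$, let $\Psi_1,\Psi_2$ be Orlicz functions, and let $I_\mu\colon\mathfrak{B}^{\Psi_1}\to L^{\Psi_2}(\mu)$ be the canonical map $I_\mu(f)=f$. (1) If $I_\mu$ is bounded, then there is a constant $A>0$ such that $$\rho_\mu(h)\le\frac{1}{\Psi_2\big[A\,\Psi_1^{-1}(1/h^2)\big]}\quad\text{for all }0<h<1.$$ (2) For $I_\mu$ to be bounded, it suffices that there is a constant $A>0$ such that $$K_{\mu,2}(h)\le\frac{1/h^2}{\Psi_2\big[A\,\Psi_1^{-1}(1/h^2)\big]}\quad\text{for all }0<h<1.$$
   Context: $\mathbb{D}$ is the open unit disk, $\mathbb{T}$ the unit circle, $\mathcal{A}$ the normalized area measure $dx\,dy/\pi$. An Orlicz function is a nonnegative increasing convex $\Psi\colon[0,\infty)\to[0,\infty)$ with $\Psi(0)=0$, $\Psi(x)>0$ for $x>0$, $\Psi(\infty)=\infty$. $L^{\Psi}(\mu)$ is the Orlicz space with Luxemburg norm $\|f\|=\inf\{C>0:\int\Psi(|f|/C)\,d\mu\le1\}$; $\mathfrak{B}^{\Psi}$ is the subspace of $L^{\Psi}(\mathbb{D},\mathcal{A})$ of analytic functions. For $\xi\in\mathbb{T}$, $0<h\le1$: $W(\xi,h)=\{z\in\mathbb{D}:|z|\ge1-h,\ |\arg(z\bar\xi)|\le\pi h\}$; $\rho_\mu(h)=\sup_{\xi\in\mathbb{T}}\mu(W(\xi,h))$; $K_{\mu,2}(h)=\sup_{0<t<h}\rho_\mu(t)/t^2$.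 "Bounded" in (2) includes that every $f\in\mathfrak{B}^{\Psi_1}$ lies in $L^{\Psi_2}(\mu)$. *)

theory Defs
  imports "HOL-Analysis.Analysis"
begin

definition unit_disk :: "complex set" where
  "unit_disk = ball 0 1"

definition area_measure :: "complex measure" where
  "area_measure = density (restrict_space lborel unit_disk) (\<lambda>_. ennreal (1 / pi))"

text \<open>Orlicz function (only its values on [0,infinity) matter).\<close>
definition orlicz_function :: "(real \<Rightarrow> real) \<Rightarrow> bool" where
  "orlicz_function \<Psi> \<longleftrightarrow>
     (\<forall>x\<ge>0. 0 \<le> \<Psi> x) \<and> mono_on {0..} \<Psi> \<and> convex_on {0..} \<Psi> \<and>
     \<Psi> 0 = 0 \<and> (\<forall>x>0. 0 < \<Psi> x) \<and> filterlim \<Psi> at_top at_top"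

text \<open>Inverse of an Orlicz function (a bijection of [0,infinity)).\<close>
definition orlicz_inv :: "(real \<Rightarrow> real) \<Rightarrow> real \<Rightarrow> real" where
  "orlicz_inv \<Psi> y = (THE x. 0 \<le> x \<and> \<Psi> x = y)"

definition orlicz_space :: "(real \<Rightarrow> real) \<Rightarrow> 'a measure \<Rightarrow> ('a \<Rightarrow> complex) set" where
  "orlicz_space \<Psi> M =
     {f. f \<in> borel_measurable M \<and>
         (\<exists>C>0. (\<integral>\<^sup>+ x. ennreal (\<Psi> (norm (f x) / C)) \<partial>M) \<le> 1)}"

definition luxemburg_norm :: "(real \<Rightarrow> real) \<Rightarrow> 'a measure \<Rightarrow> ('a \<Rightarrow> complex) \<Rightarrow> real" where
  "luxemburg_norm \<Psi> M f =
     Inf {C. 0 < C \<and> (\<integral>\<^sup>+ x. ennreal (\<Psi> (norm (f x) / C)) \<partial>M) \<le> 1}"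

definition bergman_orlicz :: "(real \<Rightarrow> real) \<Rightarrow> (complex \<Rightarrow> complex) set" where
  "bergman_orlicz \<Psi> = {f. f holomorphic_on unit_disk \<and> f \<in> orlicz_space \<Psi> area_measure}"

definition embedding_bounded ::
    "(real \<Rightarrow> real) \<Rightarrow> (real \<Rightarrow> real) \<Rightarrow> complex measure \<Rightarrow> bool" where
  "embedding_bounded \<Psi>1 \<Psi>2 \<mu> \<longleftrightarrow>
     bergman_orlicz \<Psi>1 \<subseteq> orlicz_space \<Psi>2 \<mu> \<and>
     (\<exists>M. \<forall>f\<in>bergman_orlicz \<Psi>1.
        luxemburg_norm \<Psi>2 \<mu> f \<le> M * luxemburg_norm \<Psi>1 area_measure f)"

definition window :: "complex \<Rightarrow> real \<Rightarrow> complex set" where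
  "window \<xi> h = {z \<in> unit_disk. 1 - h \<le> norm z \<and> \<bar>Arg (z * cnj \<xi>)\<bar> \<le> pi * h}"

definition rho :: "complex measure \<Rightarrow> real \<Rightarrow> real" where
  "rho \<mu> h = Sup ((\<lambda>\<xi>. measure \<mu> (window \<xi> h)) ` sphere 0 1)"

text \<open>K_{mu,2}(h), possibly infinite, hence extended-real valued.\<close>
definition K_mu2 :: "complex measure \<Rightarrow> real \<Rightarrow> ereal" where
  "K_mu2 \<mu> h = (SUP t\<in>{0<..<h}. ereal (rho \<mu> t / t^2))"

end

theory Submission
  imports Defs "HOL-Complex_Analysis.Cauchy_Integral_Formula"
begin

text \<open>(1) Test the embedding on \<open>f z = h\<^sup>2 / (86 * (1 - cnj a * z) ^ 4)\<close> with \<open>a = (1 - h) * \<xi>\<close>: its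
  \<open>L\<^sup>1\<close> norm is at most \<open>1\<close> and its supremum at most \<open>1 / h\<^sup>2\<close>, which by convexity bounds its Luxemburg norm
  by \<open>1 / (h\<^sup>2 * \<Psi>1\<^sup>-\<^sup>1 (1 / h\<^sup>2))\<close>, while \<open>norm (f z)\<close> is of order \<open>1 / h\<^sup>2\<close> on \<open>W(\<xi>, h)\<close>.

  (2) Let \<open>u = \<Psi>1 (norm g / 64)\<close> where \<open>\<Psi>1 (norm g)\<close> has integral at most \<open>1\<close>. By the sub-mean value property
  on \<open>ball z ((1 - norm z) / 2)\<close>, \<open>u z \<le> 1 / (4 * (1 - norm z))\<^sup>2\<close>. Where \<open>u z > 1\<close>, the hypothesis at \<open>h = 1 / sqrt (u z)\<close>
  therefore gives \<open>\<Psi>2 (A * norm (g z) / 64) \<le> u z / K (4 * (1 - norm z))\<close>. Replacing \<open>u z\<close> by its average and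
  exchanging the integrations, the \<open>\<mu>\<close>-mass of a window of size \<open>t\<close> cancels \<open>K\<close> up to the factor \<open>t\<^sup>2\<close>, which the
  normalisation of the average absorbs. The exponent \<open>2\<close> is that of the area, so no maximal function is needed.\<close>

subsection \<open>Orlicz functions\<close>

lemma orlicz_function_nonneg: "orlicz_function \<Psi> \<Longrightarrow> 0 \<le> x \<Longrightarrow> 0 \<le> \<Psi> x"
  and orlicz_function_pos: "orlicz_function \<Psi> \<Longrightarrow> 0 < x \<Longrightarrow> 0 < \<Psi> x"
  and orlicz_function_zero: "orlicz_function \<Psi> \<Longrightarrow> \<Psi> 0 = 0"
  and orlicz_function_mono: "orlicz_function \<Psi> \<Longrightarrow> 0 \<le> x \<Longrightarrow> x \<le> y \<Longrightarrow> \<Psi> x \<le> \<Psi> y"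
  by (auto simp: orlicz_function_def mono_on_def)

text \<open>Convexity on the segment from \<open>0\<close>, where \<open>\<Psi>\<close> vanishes.
  This is how constants are moved out of \<open>\<Psi>\<close>, which need not be
  homogeneous.\<close>

lemma orlicz_function_scale:
  assumes "orlicz_function \<Psi>" "0 \<le> t" "t \<le> 1" "0 \<le> x"
  shows "\<Psi> (t * x) \<le> t * \<Psi> x"
  using assms convex_onD[of "{0..}" \<Psi> t 0 x] by (auto simp: orlicz_function_def)

text \<open>Monotonicity is assumed only in the weak sense; strictness comes from the chord through
  the origin, since \<open>\<Psi> y\<close> is positive.\<close>

lemma orlicz_function_strict_mono:
  assumes \<Psi>: "orlicz_function \<Psi>" and "0 \<le> x" "x < y"
  shows "\<Psi> x < \<Psi> y"
proof -
  have "\<Psi> x = \<Psi> (x / y * y)" using assms by simp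
  also have "\<dots> \<le> x / y * \<Psi> y"
    using assms by (intro orlicz_function_scale) auto
  also have "\<dots> < 1 * \<Psi> y"
    using assms orlicz_function_pos[OF \<Psi>, of y] by (intro mult_strict_right_mono) auto
  finally show ?thesis by simp
qed

text \<open>Convexity gives continuity on the open half-line; at the endpoint \<open>0\<close> the
  function is squeezed between \<open>0\<close> and its chord \<open>t * \<Psi> 1\<close>.\<close>

lemma orlicz_function_continuous_on:
  assumes \<Psi>: "orlicz_function \<Psi>"
  shows "continuous_on {0..} \<Psi>"
proof -
  have "convex_on {0<..} \<Psi>"
    using \<Psi> by (auto simp: orlicz_function_def intro: convex_on_subset)
  then have cont: "continuous_on {0<..} \<Psi>"
    by (intro convex_on_continuous) auto
  have "continuous (at x within {0..}) \<Psi>" if "0 \<le> x" for x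
  proof (cases "x = 0")
    case True
    have lim: "((\<lambda>t. t * \<Psi> 1) \<longlongrightarrow> 0) (at 0 within {0..})"
      by (auto intro!: tendsto_eq_intros)
    have ev: "eventually (\<lambda>t. t \<in> {0..1}) (at (0::real) within {0..})"
      by (auto simp: eventually_at intro!: exI[of _ 1])
    have "eventually (\<lambda>t. 0 \<le> \<Psi> t) (at 0 within {0..})"
      using ev by (rule eventually_mono) (auto intro: orlicz_function_nonneg[OF \<Psi>])
    moreover have "eventually (\<lambda>t. \<Psi> t \<le> t * \<Psi> 1) (at 0 within {0..})"
      using ev by (rule eventually_mono) (use orlicz_function_scale[OF \<Psi>, of _ 1] in auto)
    ultimately have "(\<Psi> \<longlongrightarrow> 0) (at 0 within {0..})"
      using tendsto_const lim by (rule tendsto_sandwich)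
    then show ?thesis
      using True orlicz_function_zero[OF \<Psi>] by (simp add: continuous_within)
  next
    case False
    then have "isCont \<Psi> x"
      using cont that by (auto simp: continuous_on_eq_continuous_at)
    then show ?thesis
      by (rule continuous_at_imp_continuous_at_within)
  qed
  then show ?thesis
    by (auto simp: continuous_on_eq_continuous_within)
qed

text \<open>Intermediate value theorem. Together with strict monotonicity it makes the description
  in \<open>orlicz_inv\<close> well defined on nonnegative arguments.\<close>

lemma orlicz_function_surj:
  assumes \<Psi>: "orlicz_function \<Psi>" and y: "0 \<le> y"
  shows "\<exists>x\<ge>0. \<Psi> x = y"
proof -
  have "eventually (\<lambda>x. y \<le> \<Psi> x) at_top"
    using \<Psi> by (auto simp: orlicz_function_def filterlim_at_top)
  then obtain b where b: "\<And>x. b \<le> x \<Longrightarrow> y \<le> \<Psi> x"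
    by (auto simp: eventually_at_top_linorder)
  have "\<exists>x\<ge>0. x \<le> max 0 b \<and> \<Psi> x = y"
    using b[of "max 0 b"] y orlicz_function_zero[OF \<Psi>]
    by (intro IVT') (auto intro: continuous_on_subset[OF orlicz_function_continuous_on[OF \<Psi>]])
  then show ?thesis by blast
qed

lemma orlicz_inv_eqI:
  assumes \<Psi>: "orlicz_function \<Psi>" and "0 \<le> x"
  shows "orlicz_inv \<Psi> (\<Psi> x) = x"
  unfolding orlicz_inv_def
  using assms orlicz_function_strict_mono[OF \<Psi>]
  by (intro the_equality) (auto, metis linorder_cases less_irrefl)

lemma orlicz_inv_nonneg: "orlicz_function \<Psi> \<Longrightarrow> 0 \<le> y \<Longrightarrow> 0 \<le> orlicz_inv \<Psi> y"
  and orlicz_function_inv: "orlicz_function \<Psi> \<Longrightarrow> 0 \<le> y \<Longrightarrow> \<Psi> (orlicz_inv \<Psi> y) = y"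
  using orlicz_function_surj[of \<Psi> y] orlicz_inv_eqI[of \<Psi>] by metis+

lemma orlicz_inv_pos:
  assumes \<Psi>: "orlicz_function \<Psi>" and "0 < y"
  shows "0 < orlicz_inv \<Psi> y"
  using assms orlicz_inv_nonneg[OF \<Psi>, of y] orlicz_function_inv[OF \<Psi>, of y] orlicz_function_zero[OF \<Psi>]
  by (cases "orlicz_inv \<Psi> y = 0") auto

text \<open>\<open>\<Psi>\<close> is unconstrained on negative reals and may be non-measurable
  there; \<open>\<Psi> (max 0 t)\<close> is monotone on the whole line.\<close>

lemma borel_measurable_orlicz_function:
  assumes \<Psi>: "orlicz_function \<Psi>" and f: "f \<in> borel_measurable M" and nn: "\<And>x. 0 \<le> f x"
  shows "(\<lambda>x. \<Psi> (f x)) \<in> borel_measurable M"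
proof -
  have "mono (\<lambda>t. \<Psi> (max 0 t))"
    using orlicz_function_mono[OF \<Psi>] by (auto simp: mono_def max_def)
  then have "(\<lambda>x. \<Psi> (max 0 (f x))) \<in> borel_measurable M"
    by (intro measurable_compose[OF f borel_measurable_mono])
  moreover have "max 0 (f x) = f x" for x using nn by simp
  ultimately show ?thesis by simp
qed

text \<open>Jensen's inequality, obtained by integrating a supporting line of \<open>\<Psi>\<close> at \<open>s\<close>.\<close>

lemma orlicz_function_jensen:
  fixes f :: "'a \<Rightarrow> real"
  assumes \<Psi>: "orlicz_function \<Psi>" and f[measurable]: "f \<in> borel_measurable M"
    and nn: "\<And>x. 0 \<le> f x" and fin: "emeasure M (space M) < \<infinity>"
    and s: "0 \<le> s" and le: "ennreal s * emeasure M (space M) \<le> (\<integral>\<^sup>+x. ennreal (f x) \<partial>M)"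
  shows "ennreal (\<Psi> s) * emeasure M (space M) \<le> (\<integral>\<^sup>+x. ennreal (\<Psi> (f x)) \<partial>M)"
proof (cases "s = 0")
  case True
  then show ?thesis using orlicz_function_zero[OF \<Psi>] by simp
next
  case False
  with s have s: "0 < s" by simp
  have cv: "convex_on {0..} \<Psi>" using \<Psi> by (simp add: orlicz_function_def)
  obtain k where k: "\<And>y. 0 \<le> y \<Longrightarrow> \<Psi> s + k * (y - s) \<le> \<Psi> y"
    using convex_le_Inf_differential[OF cv, of s] s by auto
  \<comment> \<open>Evaluating the supporting line at \<open>0\<close> shows that its slope is
    positive, so the slope survives as a factor in \<open>ennreal\<close>.\<close>
  have "\<Psi> s \<le> k * s" using k[of 0] orlicz_function_zero[OF \<Psi>] by (simp add: algebra_simps)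
  then have "0 < k * s" using orlicz_function_pos[OF \<Psi> s] by linarith
  then have k0: "0 \<le> k" using s by (simp add: zero_less_mult_iff)
  have [measurable]: "(\<lambda>x. \<Psi> (f x)) \<in> borel_measurable M"
    by (rule borel_measurable_orlicz_function[OF \<Psi> f nn])
  let ?m = "emeasure M (space M)"
  \<comment> \<open>To avoid subtraction in \<open>ennreal\<close>, the term \<open>k * s\<close> is
    kept on both sides and cancelled at the end, which is where finiteness of the total mass
    enters.\<close>
  have "ennreal (\<Psi> s) * ?m + ennreal (k * s) * ?m
      \<le> ennreal (\<Psi> s) * ?m + ennreal k * (\<integral>\<^sup>+x. ennreal (f x) \<partial>M)"
    using le k0 s by (auto simp: ennreal_mult mult.assoc intro!: add_left_mono mult_left_mono)
  also have "\<dots> = (\<integral>\<^sup>+x. ennreal (\<Psi> s) + ennreal k * ennreal (f x) \<partial>M)"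
    by (simp add: nn_integral_add nn_integral_cmult)
  also have "\<dots> \<le> (\<integral>\<^sup>+x. ennreal (\<Psi> (f x)) + ennreal (k * s) \<partial>M)"
  proof (intro nn_integral_mono)
    fix x
    have "\<Psi> s + k * f x \<le> \<Psi> (f x) + k * s"
      using k[OF nn[of x]] by (simp add: algebra_simps)
    then show "ennreal (\<Psi> s) + ennreal k * ennreal (f x) \<le> ennreal (\<Psi> (f x)) + ennreal (k * s)"
      using k0 s nn[of x] orlicz_function_nonneg[OF \<Psi>]
      by (simp flip: ennreal_mult ennreal_plus)
  qed
  also have "\<dots> = (\<integral>\<^sup>+x. ennreal (\<Psi> (f x)) \<partial>M) + ennreal (k * s) * ?m"
    by (simp add: nn_integral_add)
  finally have "ennreal (k * s) * ?m + ennreal (\<Psi> s) * ?m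
      \<le> ennreal (k * s) * ?m + (\<integral>\<^sup>+x. ennreal (\<Psi> (f x)) \<partial>M)"
    by (simp only: add.commute)
  moreover have "ennreal (k * s) * ?m \<noteq> top"
    using fin by (simp add: ennreal_mult_eq_top_iff)
  ultimately show ?thesis
    unfolding ennreal_add_left_cancel_le by (simp add: infinity_ennreal_def)
qed

subsection \<open>Area means of holomorphic functions\<close>

text \<open>Invariance of Lebesgue measure under a linear isometry \<open>T\<close>: both \<open>lborel\<close> and its image under
  \<open>T\<close> are translation invariant, so by Fubini they are proportional, and they agree on the unit ball.\<close>

lemma distr_lborel_linear_isometry:
  fixes T :: "'a::euclidean_space \<Rightarrow> 'a"
  assumes lin: "linear T" and iso: "\<And>x. norm (T x) = norm x"
  shows "distr lborel borel T = lborel"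
proof -
  have [measurable]: "T \<in> borel_measurable borel"
    using lin by (intro borel_measurable_continuous_onI linear_continuous_on) (simp add: linear_conv_bounded_linear)
  have "surj T"
    using lin iso linear_injective_imp_surjective[OF lin] linear_injective_0[OF lin] by (metis norm_eq_zero)
  define N where "N = distr lborel borel T"
  have sN[measurable_cong, simp]: "sets N = sets borel" and spN[simp]: "space N = UNIV" by (simp_all add: N_def)
  have tr_lb: "(\<integral>\<^sup>+x. g (x + c) \<partial>lborel) = (\<integral>\<^sup>+x. g x \<partial>lborel)"
    if [measurable]: "g \<in> borel_measurable borel" for g and c :: 'a
  proof -
    have "(\<integral>\<^sup>+x. g x \<partial>lborel) = (\<integral>\<^sup>+x. g x \<partial>distr lborel borel ((+) c))"
      by (simp add: lborel_distr_plus)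
    then show ?thesis by (simp add: nn_integral_distr add.commute)
  qed
  have tr_N: "(\<integral>\<^sup>+x. g (x + c) \<partial>N) = (\<integral>\<^sup>+x. g x \<partial>N)"
    if [measurable]: "g \<in> borel_measurable borel" for g and c :: 'a
  proof -
    \<comment> \<open>A translation by \<open>c\<close> after \<open>T\<close> is a translation by
      \<open>b\<close> before it.\<close>
    obtain b where b: "c = T b" using \<open>surj T\<close> by (metis surjD)
    have "(\<integral>\<^sup>+x. g (x + c) \<partial>N) = (\<integral>\<^sup>+x. g (T x + T b) \<partial>lborel)"
      by (simp add: N_def nn_integral_distr b)
    also have "\<dots> = (\<integral>\<^sup>+x. g (T (x + b)) \<partial>lborel)"
      by (simp add: linear_add[OF lin])
    also have "\<dots> = (\<integral>\<^sup>+x. g (T x) \<partial>lborel)"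
      by (rule tr_lb[of "\<lambda>x. g (T x)"]) simp
    finally show ?thesis by (simp add: N_def nn_integral_distr)
  qed
  have N_ball: "emeasure N (ball 0 r) = emeasure lborel (ball 0 r :: 'a set)" for r
    by (auto simp: N_def emeasure_distr iso intro!: arg_cong[where f="emeasure lborel"])
  interpret N: sigma_finite_measure N
  proof
    show "\<exists>A. countable A \<and> A \<subseteq> sets N \<and> \<Union> A = space N \<and> (\<forall>a\<in>A. emeasure N a \<noteq> \<infinity>)"
    proof (intro exI[of _ "range (\<lambda>n. ball 0 (real n))"] conjI)
      show "\<Union> (range (\<lambda>n. ball (0::'a) (real n))) = space N"
        by (auto intro: reals_Archimedean2)
    qed (auto simp: N_ball emeasure_ball)
  qed
  interpret P: pair_sigma_finite N lborel ..
  define B where "B = ball (0::'a) 1"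
  have [measurable]: "B \<in> sets borel" by (simp add: B_def)
  \<comment> \<open>Lets the integral over \<open>N\<close> see a translate of \<open>B\<close>
    itself rather than of its reflection.\<close>
  have sym: "indicator B (y - x) = (indicator B (x - y) :: ennreal)" for x y
    by (simp add: B_def indicator_def norm_minus_commute)
  let ?m = "emeasure lborel B"
  have m: "?m \<noteq> 0" "?m \<noteq> \<infinity>"
    using unit_ball_vol_pos[of "real DIM('a)"] by (simp_all add: B_def emeasure_ball del: unit_ball_vol_pos)
  have "emeasure N A = emeasure lborel A" if [measurable]: "A \<in> sets borel" for A
  proof -
    \<comment> \<open>Evaluating one double integral in both orders gives
      \<open>emeasure N A * ?m = emeasure lborel A * emeasure N B\<close>, and
      \<open>emeasure N B = ?m\<close> because isometries preserve centred balls.\<close>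
    have "emeasure N A * ?m = (\<integral>\<^sup>+y. emeasure N A * indicator B y \<partial>lborel)"
      by (simp add: nn_integral_cmult_indicator)
    also have "\<dots> = (\<integral>\<^sup>+y. (\<integral>\<^sup>+x. indicator A (x + y) \<partial>N) * indicator B y \<partial>lborel)"
      by (subst tr_N) simp_all
    also have "\<dots> = (\<integral>\<^sup>+y. (\<integral>\<^sup>+x. indicator A (x + y) * indicator B y \<partial>N) \<partial>lborel)"
      by (simp add: nn_integral_multc)
    also have "\<dots> = (\<integral>\<^sup>+x. (\<integral>\<^sup>+y. indicator A (x + y) * indicator B y \<partial>lborel) \<partial>N)"
      by (rule P.Fubini') measurable
    also have "\<dots> = (\<integral>\<^sup>+x. (\<integral>\<^sup>+y. indicator A y * indicator B (y - x) \<partial>lborel) \<partial>N)"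
    proof (rule nn_integral_cong)
      fix x :: 'a
      show "(\<integral>\<^sup>+y. indicator A (x + y) * indicator B y \<partial>lborel)
          = (\<integral>\<^sup>+y. indicator A y * indicator B (y - x) \<partial>lborel)"
        using tr_lb[of "\<lambda>y. indicator A y * indicator B (y - x)" x] by (simp add: add.commute)
    qed
    also have "\<dots> = (\<integral>\<^sup>+y. (\<integral>\<^sup>+x. indicator A y * indicator B (y - x) \<partial>N) \<partial>lborel)"
      by (rule P.Fubini'[symmetric]) measurable
    also have "\<dots> = (\<integral>\<^sup>+y. indicator A y * (\<integral>\<^sup>+x. indicator B (x + - y) \<partial>N) \<partial>lborel)"
      using sym by (simp add: nn_integral_cmult)
    also have "\<dots> = (\<integral>\<^sup>+y. indicator A y * emeasure N B \<partial>lborel)"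
      by (subst tr_N) simp_all
    also have "\<dots> = emeasure lborel A * ?m"
      by (simp add: nn_integral_multc B_def N_ball)
    finally show ?thesis
      using m mult_divide_eq_ennreal[of ?m] by (metis infinity_ennreal_def)
  qed
  then show ?thesis
    unfolding N_def[symmetric] by (intro measure_eqI) simp_all
qed

text \<open>Cauchy's formula on the unit circle for \<open>f (z + w * \<zeta>)\<close> as a function
  of \<open>\<zeta>\<close>. A complex \<open>w\<close> in place of a radius expresses the mean
  through rotations of \<open>w\<close>, so the area mean needs no polar coordinates.\<close>

lemma circle_mean_le:
  fixes f :: "complex \<Rightarrow> complex"
  assumes f: "f holomorphic_on ball z R" and w: "norm w < R"
  shows "ennreal (norm (f z)) \<le> (\<integral>\<^sup>+t. ennreal (norm (f (z + exp (2 * pi * t * \<i>) * w))) * indicator {0..1} t \<partial>lborel)"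
proof -
  define g where "g \<zeta> = f (z + w * \<zeta>)" for \<zeta>
  have sub: "(\<lambda>\<zeta>. z + w * \<zeta>) ` cball 0 1 \<subseteq> ball z R"
    using w by (auto simp: dist_norm norm_mult intro!: le_less_trans[OF mult_left_le[of _ "norm w"]])
  have "(f \<circ> (\<lambda>\<zeta>. z + w * \<zeta>)) holomorphic_on cball 0 1"
    by (intro holomorphic_on_compose_gen[OF _ f] holomorphic_intros sub)
  then have g: "g holomorphic_on cball 0 1"
    by (simp add: g_def[abs_def] comp_def)
  have "((\<lambda>u. g u / (u - 0)) has_contour_integral (2 * of_real pi * \<i> * g 0)) (circlepath 0 1)"
    by (intro Cauchy_integral_circlepath_simple g) simp
  then have "((\<lambda>t. (2 * of_real pi * \<i>) * g (exp (2 * of_real pi * of_real t * \<i>))) has_integral ((2 * of_real pi * \<i>) * g 0)) {0..1}"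
    unfolding has_contour_integral_def
    by (rule has_integral_eq[rotated])
       (simp add: vector_derivative_circlepath01, simp add: circlepath algebra_simps)
  then have I: "((\<lambda>t. g (exp (2 * of_real pi * of_real t * \<i>))) has_integral (g 0)) {0..1}"
    by (simp add: has_integral_mult_right_iff)
  have cont: "continuous_on {0..1::real} (\<lambda>t. g (exp (2 * of_real pi * of_real t * \<i>)))"
    by (intro continuous_on_compose2[OF holomorphic_on_imp_continuous_on[OF g]] continuous_intros) 
       (auto simp: norm_exp_eq_Re)
  then have int: "(\<lambda>t. norm (g (exp (2 * of_real pi * of_real t * \<i>)))) integrable_on {0..1::real}"
    by (intro integrable_continuous_real continuous_intros)
  have m: "(\<lambda>t. norm (g (exp (2 * of_real pi * of_real t * \<i>))) * indicator {0..1::real} t) \<in> borel_measurable borel"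
    using borel_measurable_continuous_on_indicator[OF _ continuous_on_norm[OF cont]]
    by (simp add: mult.commute)
  have "norm (g 0) \<le> integral {0..1} (\<lambda>t. norm (g (exp (2 * of_real pi * of_real t * \<i>))))"
    using integral_norm_bound_integral[OF has_integral_integrable[OF I] int] integral_unique[OF I] by simp
  also have "ennreal \<dots> = (\<integral>\<^sup>+t. ennreal (norm (g (exp (2 * of_real pi * of_real t * \<i>)))) * indicator {0..1} t \<partial>lborel)"
  proof -
    have "(\<integral>\<^sup>+t. ennreal (norm (g (exp (2 * of_real pi * of_real t * \<i>)))) * indicator {0..1} t \<partial>lborel)
       = (\<integral>\<^sup>+t. ennreal (indicator {0..1} t * norm (g (exp (2 * of_real pi * of_real t * \<i>)))) \<partial>lborel)"
      by (intro nn_integral_cong) (simp add: indicator_def)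
    then show ?thesis
      using nn_integral_has_integral_lebesgue[OF _ integrable_integral[OF int]] m
      by (simp add: nn_integral_completion mult.commute)
  qed
  finally show ?thesis
    by (simp add: g_def ennreal_leI mult.commute mult.left_commute)
qed

text \<open>Integrate the circle means over \<open>w\<close> in \<open>ball 0 r\<close> and exchange
  the integrals: every rotation preserves Lebesgue measure, so each \<open>t\<close> contributes the
  same amount.\<close>

lemma area_mean_le:
  fixes f :: "complex \<Rightarrow> complex"
  assumes f: "f holomorphic_on ball z r"
  shows "ennreal (norm (f z)) * emeasure lborel (ball z r)
    \<le> (\<integral>\<^sup>+w. ennreal (norm (f w)) * indicator (ball z r) w \<partial>lborel)"
proof -
  define G where "G w = ennreal (norm (f w)) * indicator (ball z r) w" for w
  have [measurable]: "G \<in> borel_measurable borel"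
  proof -
    have "(\<lambda>w. norm (f w) * indicator (ball z r) w) \<in> borel_measurable borel"
      using borel_measurable_continuous_on_indicator[OF _ continuous_on_norm[OF holomorphic_on_imp_continuous_on[OF f]]]
      by (simp add: mult.commute)
    then have "(\<lambda>w. ennreal (norm (f w) * indicator (ball z r) w)) \<in> borel_measurable borel"
      by measurable
    also have "(\<lambda>w. ennreal (norm (f w) * indicator (ball z r) w)) = G"
      by (auto simp: G_def indicator_def)
    finally show ?thesis .
  qed
  have tr: "(\<integral>\<^sup>+w. g (z + w) \<partial>lborel) = (\<integral>\<^sup>+w. g w \<partial>lborel)"
    if [measurable]: "g \<in> borel_measurable borel" for g
    using lborel_distr_plus[of z] nn_integral_distr[of "(+) z" lborel borel g] by simp
  have rot: "(\<integral>\<^sup>+w. G (z + exp (2 * pi * t * \<i>) * w) \<partial>lborel) = (\<integral>\<^sup>+w. G w \<partial>lborel)" for t :: real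
  proof -
    let ?T = "\<lambda>w. exp (2 * pi * t * \<i>) * w"
    have "distr lborel borel ?T = lborel"
      by (intro distr_lborel_linear_isometry) (auto simp: norm_mult norm_exp_eq_Re intro!: bounded_linear.linear bounded_linear_mult_right)
    then have "(\<integral>\<^sup>+w. G (z + w) \<partial>lborel) = (\<integral>\<^sup>+w. G (z + w) \<partial>distr lborel borel ?T)"
      by simp
    also have "\<dots> = (\<integral>\<^sup>+w. G (z + ?T w) \<partial>lborel)"
      by (subst nn_integral_distr) simp_all
    finally show ?thesis using tr[of G] by simp
  qed
  have "ennreal (norm (f z)) * emeasure lborel (ball z r)
      = (\<integral>\<^sup>+w. ennreal (norm (f z)) * indicator (ball 0 r) w \<partial>(lborel :: complex measure))"
    by (cases "0 \<le> r") (simp_all add: nn_integral_cmult_indicator emeasure_ball ball_empty)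
  also have "\<dots> \<le> (\<integral>\<^sup>+w. (\<integral>\<^sup>+t. G (z + exp (2 * pi * t * \<i>) * w) * indicator {0..1} t \<partial>lborel) \<partial>lborel)"
  proof (intro nn_integral_mono)
    fix w :: complex
    show "ennreal (norm (f z)) * indicator (ball 0 r) w
        \<le> (\<integral>\<^sup>+t. G (z + exp (2 * pi * t * \<i>) * w) * indicator {0..1} t \<partial>lborel)"
      using circle_mean_le[OF f, of w]
      by (cases "norm w < r") (simp_all add: G_def dist_norm norm_mult norm_exp_eq_Re)
  qed
  also have "\<dots> = (\<integral>\<^sup>+t. (\<integral>\<^sup>+w. G (z + exp (2 * pi * t * \<i>) * w) * indicator {0..1} t \<partial>lborel) \<partial>(lborel :: real measure))"
    by (rule lborel_pair.Fubini') measurable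
  also have "\<dots> = (\<integral>\<^sup>+t. (\<integral>\<^sup>+w. G w \<partial>lborel) * indicator {0..1} (t::real) \<partial>lborel)"
    using rot by (simp add: nn_integral_multc)
  also have "\<dots> = (\<integral>\<^sup>+w. G w \<partial>lborel)"
    by (simp add: nn_integral_cmult)
  finally show ?thesis by (simp add: G_def)
qed

text \<open>Subharmonicity of \<open>\<Psi> (norm (f z))\<close>: Jensen's inequality on the ball,
  fed with the area mean inequality for \<open>norm (f z)\<close>.\<close>

lemma orlicz_function_area_mean_le:
  fixes f :: "complex \<Rightarrow> complex"
  assumes \<Psi>: "orlicz_function \<Psi>" and f: "f holomorphic_on ball z r"
  shows "ennreal (\<Psi> (norm (f z))) * emeasure lborel (ball z r)
    \<le> (\<integral>\<^sup>+w. ennreal (\<Psi> (norm (f w))) * indicator (ball z r) w \<partial>lborel)"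
proof -
  let ?M = "restrict_space lborel (ball z r)"
  have m: "(\<lambda>w. norm (f w)) \<in> borel_measurable ?M"
  proof -
    have s: "sets ?M = sets (restrict_space borel (ball z r))"
      by (simp cong: sets_restrict_space_cong)
    show ?thesis
      using borel_measurable_continuous_on_restrict[OF continuous_on_norm[OF holomorphic_on_imp_continuous_on[OF f]]]
        measurable_cong_sets[OF s refl, of borel] by simp
  qed
  have M: "emeasure ?M (space ?M) = emeasure lborel (ball z r)"
    by (simp add: emeasure_restrict_space space_restrict_space)
  have "ennreal (\<Psi> (norm (f z))) * emeasure ?M (space ?M) \<le> (\<integral>\<^sup>+w. ennreal (\<Psi> (norm (f w))) \<partial>?M)"
  proof (rule orlicz_function_jensen[OF \<Psi> m])
    show "emeasure ?M (space ?M) < \<infinity>"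
      unfolding M by (rule emeasure_lborel_ball_finite)
    show "ennreal (norm (f z)) * emeasure ?M (space ?M) \<le> (\<integral>\<^sup>+w. ennreal (norm (f w)) \<partial>?M)"
      using area_mean_le[OF f] unfolding M by (simp add: nn_integral_restrict_space)
  qed simp_all
  then show ?thesis
    unfolding M by (simp add: nn_integral_restrict_space)
qed

subsection \<open>Luxemburg norms, area measure and windows\<close>

lemma luxemburg_norm_le:
  "0 < C \<Longrightarrow> (\<integral>\<^sup>+x. ennreal (\<Psi> (norm (f x) / C)) \<partial>M) \<le> 1 \<Longrightarrow> luxemburg_norm \<Psi> M f \<le> C"
  unfolding luxemburg_norm_def by (intro cInf_lower bdd_belowI[of _ 0]) auto

text \<open>With a strict inequality some admissible \<open>c\<close> lies below \<open>C\<close>,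
  so it need not be known that the infimum is attained.\<close>

lemma nn_integral_le_one_of_luxemburg_norm_less:
  assumes \<Psi>: "orlicz_function \<Psi>" and f: "f \<in> orlicz_space \<Psi> M" and less: "luxemburg_norm \<Psi> M f < C"
  shows "(\<integral>\<^sup>+x. ennreal (\<Psi> (norm (f x) / C)) \<partial>M) \<le> 1"
proof -
  obtain c where c: "0 < c" "(\<integral>\<^sup>+x. ennreal (\<Psi> (norm (f x) / c)) \<partial>M) \<le> 1" "c < C"
    using f less cInf_lessD[of "{C. 0 < C \<and> (\<integral>\<^sup>+x. ennreal (\<Psi> (norm (f x) / C)) \<partial>M) \<le> 1}" C]
    by (auto simp: orlicz_space_def luxemburg_norm_def)
  have "(\<integral>\<^sup>+x. ennreal (\<Psi> (norm (f x) / C)) \<partial>M) \<le> (\<integral>\<^sup>+x. ennreal (\<Psi> (norm (f x) / c)) \<partial>M)"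
    using c by (intro nn_integral_mono ennreal_leI orlicz_function_mono[OF \<Psi>] divide_left_mono) auto
  with c show ?thesis by auto
qed

lemma space_area_measure: "space area_measure = unit_disk"
  by (simp add: area_measure_def space_restrict_space)

lemma sets_area_measure: "sets area_measure = sets (restrict_space borel unit_disk)"
  by (simp add: area_measure_def cong: sets_restrict_space_cong)

text \<open>Stated for any measure on the Borel sets of the disk, so that it serves
  \<open>area_measure\<close> and \<open>\<mu>\<close> alike.\<close>

lemma borel_measurable_unit_disk:
  assumes "continuous_on unit_disk f" and "sets M = sets (restrict_space borel unit_disk)"
  shows "f \<in> borel_measurable M"
  unfolding measurable_cong_sets[OF assms(2) refl] by (rule borel_measurable_continuous_on_restrict[OF assms(1)])

lemma measurable_ident_unit_disk:
  assumes "sets M = sets (restrict_space borel unit_disk)"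
  shows "(\<lambda>x. x) \<in> M \<rightarrow>\<^sub>M borel"
  by (intro borel_measurable_unit_disk[OF _ assms] continuous_intros)

lemma nn_integral_area_measure:
  assumes [measurable]: "g \<in> borel_measurable (restrict_space borel unit_disk)"
  shows "(\<integral>\<^sup>+z. g z \<partial>area_measure) = ennreal (1 / pi) * (\<integral>\<^sup>+z. g z * indicator unit_disk z \<partial>lborel)"
proof -
  have s: "sets (restrict_space lborel unit_disk) = sets (restrict_space borel unit_disk)"
    by (simp cong: sets_restrict_space_cong)
  have [measurable]: "g \<in> borel_measurable (restrict_space lborel unit_disk)"
    using assms measurable_cong_sets[OF s refl] by blast
  have D: "unit_disk \<in> sets borel" by (simp add: unit_disk_def)
  have "(\<integral>\<^sup>+z. g z \<partial>area_measure) = (\<integral>\<^sup>+z. ennreal (1 / pi) * g z \<partial>restrict_space lborel unit_disk)"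
    unfolding area_measure_def by (subst nn_integral_density) simp_all
  also have "\<dots> = ennreal (1 / pi) * (\<integral>\<^sup>+z. g z \<partial>restrict_space lborel unit_disk)"
    by (rule nn_integral_cmult) simp
  finally show ?thesis
    using D by (simp add: nn_integral_restrict_space)
qed

lemma nn_integral_area_measure_ball_le:
  assumes "0 \<le> r"
  shows "(\<integral>\<^sup>+z. indicator (ball w r) z \<partial>area_measure) \<le> ennreal (r\<^sup>2)"
proof -
  have m: "indicator (ball w r) \<in> borel_measurable (restrict_space borel unit_disk)"
    by (intro measurable_restrict_space1 borel_measurable_indicator) simp
  have "(\<integral>\<^sup>+z. indicator (ball w r) z \<partial>area_measure)
      \<le> ennreal (1 / pi) * (\<integral>\<^sup>+z. indicator (ball w r) z \<partial>lborel)"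
    unfolding nn_integral_area_measure[OF m]
    by (intro mult_left_mono nn_integral_mono) (auto simp: indicator_def)
  also have "\<dots> = ennreal (r\<^sup>2)"
    using assms by (simp add: emeasure_ball unit_ball_vol_2 flip: ennreal_mult)
  finally show ?thesis .
qed

text \<open>\<open>Arg\<close> is continuous off the slit of nonpositive reals; on the slit it
  equals \<open>pi\<close>, except for the value \<open>0\<close> at the origin.\<close>

lemma borel_measurable_Arg [measurable]: "Arg \<in> borel_measurable borel"
proof -
  have cl: "closed (\<real>\<^sub>\<le>\<^sub>0 :: complex set)" by (rule closed_nonpos_Reals_complex)
  have "(\<lambda>z. indicator (- \<real>\<^sub>\<le>\<^sub>0) z *\<^sub>R Arg z) \<in> borel_measurable borel"
    using cl by (intro borel_measurable_continuous_on_indicator continuous_on_Arg) auto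
  moreover have "(\<lambda>z::complex. indicator (\<real>\<^sub>\<le>\<^sub>0 - {0}) z *\<^sub>R pi) \<in> borel_measurable borel"
    using cl by (intro borel_measurable_scaleR borel_measurable_indicator) auto
  ultimately have "(\<lambda>z. indicator (- \<real>\<^sub>\<le>\<^sub>0) z *\<^sub>R Arg z + indicator (\<real>\<^sub>\<le>\<^sub>0 - {0}) z *\<^sub>R pi) \<in> borel_measurable borel"
    by (rule borel_measurable_add)
  also have "(\<lambda>z. indicator (- \<real>\<^sub>\<le>\<^sub>0) z *\<^sub>R Arg z + indicator (\<real>\<^sub>\<le>\<^sub>0 - {0}) z *\<^sub>R pi) = Arg"
  proof
    fix z :: complex
    have "Arg z = pi" if "z \<in> \<real>\<^sub>\<le>\<^sub>0" "z \<noteq> 0"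
      using that by (simp add: Arg_eq_pi complex_nonpos_Reals_iff complex_eq_iff less_le)
    then show "indicator (- \<real>\<^sub>\<le>\<^sub>0) z *\<^sub>R Arg z + indicator (\<real>\<^sub>\<le>\<^sub>0 - {0}) z *\<^sub>R pi = Arg z"
      by (auto simp: indicator_def Arg_zero)
  qed
  finally show ?thesis .
qed

lemma window_in_sets:
  assumes "sets \<mu> = sets (restrict_space borel unit_disk)"
  shows "window \<xi> h \<in> sets \<mu>"
proof -
  have "window \<xi> h = unit_disk \<inter> {z. 1 - h \<le> norm z \<and> \<bar>Arg (z * cnj \<xi>)\<bar> \<le> pi * h}"
    by (auto simp: window_def)
  moreover have "{z. 1 - h \<le> norm z \<and> \<bar>Arg (z * cnj \<xi>)\<bar> \<le> pi * h} \<in> sets borel"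
    by measurable
  ultimately show ?thesis
    unfolding assms by (auto simp: sets_restrict_space)
qed

text \<open>Finiteness of \<open>\<mu>\<close> bounds the set of window masses, without which the
  real \<open>Sup\<close> in \<open>rho\<close> would say nothing.\<close>

lemma measure_window_le_rho:
  assumes "finite_measure \<mu>" "norm \<xi> = 1"
  shows "measure \<mu> (window \<xi> h) \<le> rho \<mu> h"
  unfolding rho_def using assms finite_measure.bounded_measure[OF assms(1)]
  by (intro cSUP_upper bdd_aboveI[of _ "measure \<mu> (space \<mu>)"]) auto

subsection \<open>Necessity: testing on the Bergman kernel\<close>

text \<open>Pulling out the unimodular factor \<open>cnj \<xi>\<close> turns the kernel denominator
  into a distance from \<open>\<xi>\<close>.\<close>

lemma norm_kernel_eq:
  assumes "norm \<xi> = 1"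
  shows "norm (1 - cnj (of_real (1 - h) * \<xi>) * z) = norm (\<xi> - of_real (1 - h) * z)"
proof -
  have "cnj \<xi> * \<xi> = 1"
    using assms by (simp add: complex_norm_square[symmetric] mult.commute)
  then have "1 - cnj (of_real (1 - h) * \<xi>) * z = cnj \<xi> * (\<xi> - of_real (1 - h) * z)"
    by (simp add: algebra_simps)
  then show ?thesis using assms by (simp add: norm_mult)
qed

text \<open>The contracted point \<open>(1 - h) * z\<close> stays at distance \<open>h\<close> from
  the circle. Undoing the contraction moves it by at most \<open>h\<close>, hence by no more than
  the first bound, which costs the factor \<open>2\<close>.\<close>

lemma norm_kernel_ge:
  assumes "norm \<xi> = 1" "0 < h" "h < 1" "norm z < 1"
  shows "h \<le> norm (1 - cnj (of_real (1 - h) * \<xi>) * z)"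
    and "norm (\<xi> - z) / 2 \<le> norm (1 - cnj (of_real (1 - h) * \<xi>) * z)"
proof -
  have "norm (of_real (1 - h) * z) \<le> 1 - h"
    using assms by (simp add: norm_mult mult_left_le del: of_real_diff)
  then show 1: "h \<le> norm (1 - cnj (of_real (1 - h) * \<xi>) * z)"
    using norm_triangle_ineq2[of \<xi> "of_real (1 - h) * z"] assms unfolding norm_kernel_eq[OF assms(1)] by linarith
  have "norm (\<xi> - z) \<le> norm (\<xi> - of_real (1 - h) * z) + norm (of_real h * z)"
    using norm_triangle_ineq4[of "\<xi> - of_real (1 - h) * z" "of_real h * z"] by (simp add: algebra_simps)
  also have "norm (of_real h * z) \<le> h"
    using assms by (simp add: norm_mult mult_left_le)
  finally show "norm (\<xi> - z) / 2 \<le> norm (1 - cnj (of_real (1 - h) * \<xi>) * z)"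
    using 1 unfolding norm_kernel_eq[OF assms(1)] by linarith
qed

text \<open>In polar form the radial defect \<open>1 - c\<close> contributes at most
  \<open>2 * h\<close> and the angle at most \<open>pi * h\<close>, which is below
  \<open>4 * h\<close>.\<close>

lemma norm_kernel_le_on_window:
  assumes \<xi>: "norm \<xi> = 1" and h: "0 < h" "h < 1" and z: "z \<in> window \<xi> h"
  shows "norm (1 - cnj (of_real (1 - h) * \<xi>) * z) \<le> 6 * h"
proof -
  define \<theta> where "\<theta> = Arg (z * cnj \<xi>)"
  from z have z': "norm z < 1" "1 - h \<le> norm z" "\<bar>\<theta>\<bar> \<le> pi * h"
    by (auto simp: window_def unit_disk_def \<theta>_def)
  have "z * cnj \<xi> \<noteq> 0" using z' h \<xi> by auto
  then have polar: "z * cnj \<xi> = of_real (norm z) * exp (\<i> * of_real \<theta>)"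
    using Arg_eq[of "z * cnj \<xi>"] \<xi> by (simp add: \<theta>_def norm_mult)
  define c where "c = (1 - h) * norm z"
  have c: "0 \<le> c" "c \<le> 1" using z' h by (auto simp: c_def mult_le_one)
  have "1 - c \<le> 1 - (1 - h) * (1 - h)" using z' h by (simp add: c_def mult_left_mono)
  also have "\<dots> \<le> 2 * h" by (simp add: algebra_simps)
  finally have c2: "1 - c \<le> 2 * h" .
  have "1 - cnj (of_real (1 - h) * \<xi>) * z = 1 - of_real (1 - h) * (z * cnj \<xi>)"
    by simp
  also have "\<dots> = of_real (1 - c) - of_real c * (exp (\<i> * of_real \<theta>) - 1)"
    unfolding polar c_def by (simp add: algebra_simps)
  finally have "norm (1 - cnj (of_real (1 - h) * \<xi>) * z)
      \<le> norm (of_real (1 - c) :: complex) + norm (of_real c * (exp (\<i> * of_real \<theta>) - 1))"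
    by (metis norm_triangle_ineq4)
  also have "\<dots> = (1 - c) + c * norm (exp (\<i> * of_real \<theta>) - 1)"
    using c by (simp add: norm_mult del: of_real_diff)
  also have "\<dots> \<le> 2 * h + 1 * \<bar>\<theta>\<bar>"
  proof (intro add_mono mult_mono c2)
    have "norm (exp (\<i> * of_real \<theta>) - 1) = 2 * \<bar>sin (\<theta> / 2)\<bar>"
      using dist_exp_i_1[of \<theta>] by (simp add: dist_norm)
    also have "\<dots> \<le> \<bar>\<theta>\<bar>" using abs_sin_x_le_abs_x[of "\<theta> / 2"] by simp
    finally show "norm (exp (\<i> * of_real \<theta>) - 1) \<le> \<bar>\<theta>\<bar>" .
  qed (use c in auto)
  also have "\<dots> \<le> 2 * h + 4 * h"
    using z'(3) mult_right_mono[of pi 4 h] h(1) pi_less_4 by linarith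
  finally show ?thesis by simp
qed

text \<open>The disk is covered by the balls \<open>ball \<xi> (2 ^ (k + 1) * h)\<close>, and the \<open>k\<close>-th layer
  contributes at most \<open>64 / (4 ^ k * h\<^sup>2)\<close> to the integral.\<close>

lemma nn_integral_kernel_le:
  assumes \<xi>: "norm \<xi> = 1" and h: "0 < h" "h < 1"
  shows "(\<integral>\<^sup>+z. ennreal (1 / norm (1 - cnj (of_real (1 - h) * \<xi>) * z) ^ 4) \<partial>area_measure) \<le> ennreal (86 / h\<^sup>2)"
proof -
  \<comment> \<open>The coefficient is \<open>1 / (2 ^ k * h / 2) ^ 4\<close>, the bound for the
    kernel on the \<open>k\<close>-th layer.\<close>
  define T where "T k z = ennreal (16 / (16 ^ k * h ^ 4)) * indicator (ball \<xi> (2 ^ (k + 1) * h)) z" for k z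
  have T_meas: "T k \<in> borel_measurable area_measure" for k
    unfolding T_def
    by (intro measurable_compose[OF measurable_ident_unit_disk[OF sets_area_measure]]
        borel_measurable_times_ennreal borel_measurable_const borel_measurable_indicator) simp_all
  have "(\<integral>\<^sup>+z. ennreal (1 / norm (1 - cnj (of_real (1 - h) * \<xi>) * z) ^ 4) \<partial>area_measure)
      \<le> (\<integral>\<^sup>+z. (\<Sum>k. T k z) \<partial>area_measure)"
  proof (rule nn_integral_mono)
    fix z assume "z \<in> space area_measure"
    then have z: "norm z < 1" by (simp add: space_area_measure unit_disk_def)
    let ?D = "norm (1 - cnj (of_real (1 - h) * \<xi>) * z)"
    note D = norm_kernel_ge[OF \<xi> h z]
    obtain n0 :: nat where "norm (\<xi> - z) / h < 2 ^ n0"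
      using real_arch_pow[of 2 "norm (\<xi> - z) / h"] by auto
    also have "(2::real) ^ n0 \<le> 2 ^ (n0 + 1)" by simp
    finally have ex: "norm (\<xi> - z) < 2 ^ (n0 + 1) * h" using h by (simp add: field_simps)
    \<comment> \<open>One term of the series suffices. By minimality \<open>z\<close> lies outside
      the preceding ball, and the second bound of \<open>norm_kernel_ge\<close> applies; for
      \<open>n = 0\<close> the first bound does.\<close>
    define n where "n = (LEAST n. norm (\<xi> - z) < 2 ^ (n + 1) * h)"
    have n: "norm (\<xi> - z) < 2 ^ (n + 1) * h"
      unfolding n_def by (rule LeastI[of _ n0]) (rule ex)
    have "2 ^ n * h / 2 \<le> ?D"
    proof (cases n)
      case 0
      then show ?thesis using D(1) h by simp
    next
      case (Suc m)
      then have "\<not> norm (\<xi> - z) < 2 ^ (m + 1) * h"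
        using not_less_Least[of m "\<lambda>n. norm (\<xi> - z) < 2 ^ (n + 1) * h"] by (simp add: n_def)
      then show ?thesis using Suc D(2) by simp
    qed
    then have "(2 ^ n * h / 2) ^ 4 \<le> ?D ^ 4"
      using h by (intro power_mono) auto
    moreover have "0 < ?D" using D(1) h by linarith
    ultimately have "1 / ?D ^ 4 \<le> 1 / (2 ^ n * h / 2) ^ 4"
      using h by (intro divide_left_mono mult_pos_pos zero_less_power) auto
    also have "\<dots> = 16 / (16 ^ n * h ^ 4)"
      by (simp add: power_divide power_mult_distrib power_mult[symmetric] power_mult[of 2 4, simplified] mult.commute[of n])
    finally have "ennreal (1 / ?D ^ 4) \<le> T n z"
      using n by (simp add: T_def dist_norm ennreal_leI)
    also have "\<dots> \<le> (\<Sum>k. T k z)"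
      using sum_le_suminf[of "\<lambda>k. T k z" "{n}"] by simp
    finally show "ennreal (1 / ?D ^ 4) \<le> (\<Sum>k. T k z)" .
  qed
  also have "\<dots> = (\<Sum>k. \<integral>\<^sup>+z. T k z \<partial>area_measure)"
    using T_meas by (rule nn_integral_suminf)
  also have "\<dots> \<le> (\<Sum>k. ennreal (64 / h\<^sup>2 * (1 / 4) ^ k))"
  proof (rule suminf_le)
    fix k
    have m: "indicator (ball \<xi> (2 ^ (k + 1) * h)) \<in> borel_measurable area_measure"
      by (intro measurable_compose[OF measurable_ident_unit_disk[OF sets_area_measure]]
          borel_measurable_indicator) simp
    have "(\<integral>\<^sup>+z. T k z \<partial>area_measure)
        = ennreal (16 / (16 ^ k * h ^ 4)) * (\<integral>\<^sup>+z. indicator (ball \<xi> (2 ^ (k + 1) * h)) z \<partial>area_measure)"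
      unfolding T_def by (rule nn_integral_cmult[OF m])
    also have "\<dots> \<le> ennreal (16 / (16 ^ k * h ^ 4)) * ennreal ((2 ^ (k + 1) * h)\<^sup>2)"
      using h by (intro mult_left_mono nn_integral_area_measure_ball_le) auto
    also have "\<dots> = ennreal (16 / (16 ^ k * h ^ 4) * (2 ^ (k + 1) * h)\<^sup>2)"
      using h by (intro ennreal_mult[symmetric]) auto
    also have "16 / (16 ^ k * h ^ 4) * (2 ^ (k + 1) * h)\<^sup>2 = 64 / h\<^sup>2 * (1 / 4) ^ k"
    proof -
      have "(16::real) ^ k = 4 ^ k * 4 ^ k" "(2 ^ (k + 1))\<^sup>2 = 4 * (4::real) ^ k"
        by (simp_all add: power_mult_distrib[symmetric] power2_eq_square)
      then show ?thesis
        using h by (simp add: power_mult_distrib power_one_over field_simps eval_nat_numeral)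
    qed
    finally show "(\<integral>\<^sup>+z. T k z \<partial>area_measure) \<le> ennreal (64 / h\<^sup>2 * (1 / 4) ^ k)" .
  qed auto
  \<comment> \<open>The geometric series gives \<open>64 * 4 / 3 = 256 / 3\<close>, which is below
    \<open>86\<close>.\<close>
  also have "\<dots> = ennreal (64 / h\<^sup>2 * (1 / (1 - 1 / 4)))"
    using h by (intro suminf_ennreal_eq sums_mult geometric_sums) auto
  also have "\<dots> \<le> ennreal (86 / h\<^sup>2)"
    using h by (intro ennreal_leI) (simp add: field_simps)
  finally show ?thesis .
qed


lemma embedding_bounded_imp_rho_le:
  fixes \<mu> :: "complex measure"
  assumes fin: "finite_measure \<mu>" and sets: "sets \<mu> = sets (restrict_space borel unit_disk)"
    and \<Psi>1: "orlicz_function \<Psi>1" and \<Psi>2: "orlicz_function \<Psi>2"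
    and bd: "embedding_bounded \<Psi>1 \<Psi>2 \<mu>"
  shows "\<exists>A>0. \<forall>h\<in>{0<..<1}. rho \<mu> h \<le> 1 / \<Psi>2 (A * orlicz_inv \<Psi>1 (1 / h^2))"
proof -
  interpret finite_measure \<mu> by fact
  obtain M where M: "\<And>f. f \<in> bergman_orlicz \<Psi>1 \<Longrightarrow> luxemburg_norm \<Psi>2 \<mu> f \<le> M * luxemburg_norm \<Psi>1 area_measure f"
    and sub: "bergman_orlicz \<Psi>1 \<subseteq> orlicz_space \<Psi>2 \<mu>"
    using bd by (auto simp: embedding_bounded_def)
  \<comment> \<open>\<open>M\<close> may be zero or negative; \<open>N\<close> can be divided by and
    gives a strict inequality when doubled.\<close>
  define N where "N = max M 1"
  \<comment> \<open>The factors come from the normalisation \<open>86\<close> of \<open>f\<close>,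
    the bound \<open>6 * h\<close> on the window to the fourth power, and the norm bound
    \<open>2 * N\<close>.\<close>
  define A where "A = 1 / (86 * 6 ^ 4 * (2 * N))"
  have N: "1 \<le> N" "M \<le> N" by (auto simp: N_def)
  have A: "0 < A" using N by (simp add: A_def)
  have "measure \<mu> (window \<xi> h) \<le> 1 / \<Psi>2 (A * orlicz_inv \<Psi>1 (1 / h^2))"
    if h: "0 < h" "h < 1" and \<xi>: "norm \<xi> = 1" for h \<xi>
  proof -
    define s where "s = orlicz_inv \<Psi>1 (1 / h\<^sup>2)"
    have s: "0 < s" "\<Psi>1 s = 1 / h\<^sup>2"
      using h orlicz_inv_pos[OF \<Psi>1, of "1 / h\<^sup>2"] orlicz_function_inv[OF \<Psi>1, of "1 / h\<^sup>2"] by (simp_all add: s_def)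
    define k where "k z = 1 - cnj (of_real (1 - h) * \<xi>) * z" for z
    define f where "f z = of_real (h\<^sup>2 / 86) / k z ^ 4" for z
    have nf: "norm (f z) = h\<^sup>2 / 86 * (1 / norm (k z) ^ 4)" for z
      by (simp add: f_def norm_divide norm_power norm_mult)
    have k: "h \<le> norm (k z)" if "z \<in> unit_disk" for z
      using norm_kernel_ge(1)[OF \<xi> h] that by (simp add: k_def unit_disk_def)
    have k0: "k z \<noteq> 0" if "z \<in> unit_disk" for z using k[OF that] h by auto
    have hol: "f holomorphic_on unit_disk"
      using k0 unfolding f_def k_def by (intro holomorphic_intros) auto
    have int: "(\<integral>\<^sup>+z. ennreal (norm (f z)) \<partial>area_measure) \<le> 1"
    proof -
      have m: "(\<lambda>z. 1 / norm (k z) ^ 4) \<in> borel_measurable area_measure"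
        using k0 unfolding k_def
        by (intro borel_measurable_unit_disk[OF _ sets_area_measure] continuous_intros) auto
      have "(\<integral>\<^sup>+z. ennreal (norm (f z)) \<partial>area_measure)
          = ennreal (h\<^sup>2 / 86) * (\<integral>\<^sup>+z. ennreal (1 / norm (k z) ^ 4) \<partial>area_measure)"
        unfolding nf using m by (subst nn_integral_cmult[symmetric]) (simp_all add: ennreal_mult[symmetric])
      also have "\<dots> \<le> ennreal (h\<^sup>2 / 86) * ennreal (86 / h\<^sup>2)"
        unfolding k_def by (intro mult_left_mono nn_integral_kernel_le \<xi> h) simp
      also have "\<dots> = 1" using h by (simp flip: ennreal_mult)
      finally show ?thesis .
    qed
    \<comment> \<open>Since \<open>h\<^sup>2 * norm (f z) \<le> 1\<close>, scaling at
      \<open>s\<close> bounds the integrand by \<open>h\<^sup>2 * norm (f z) * \<Psi>1 s\<close>,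
      which is \<open>norm (f z)\<close> because \<open>\<Psi>1 s = 1 / h\<^sup>2\<close>.\<close>
    have int1: "(\<integral>\<^sup>+z. ennreal (\<Psi>1 (norm (f z) / (1 / (h\<^sup>2 * s)))) \<partial>area_measure) \<le> 1"
    proof -
      have "(\<integral>\<^sup>+z. ennreal (\<Psi>1 (norm (f z) / (1 / (h\<^sup>2 * s)))) \<partial>area_measure)
          \<le> (\<integral>\<^sup>+z. ennreal (norm (f z)) \<partial>area_measure)"
      proof (rule nn_integral_mono)
        fix z assume "z \<in> space area_measure"
        then have "h ^ 4 \<le> norm (k z) ^ 4"
          using k[of z] h by (intro power_mono) (auto simp: space_area_measure)
        then have "1 / norm (k z) ^ 4 \<le> 1 / h ^ 4"
          using h by (intro divide_left_mono mult_pos_pos) auto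
        then have "h\<^sup>2 * norm (f z) \<le> h\<^sup>2 * (h\<^sup>2 / 86 * (1 / h ^ 4))"
          unfolding nf by (intro mult_left_mono) auto
        also have "\<dots> \<le> 1" using h by (simp add: field_simps eval_nat_numeral)
        finally have "h\<^sup>2 * norm (f z) \<le> 1" .
        then have "\<Psi>1 ((h\<^sup>2 * norm (f z)) * s) \<le> (h\<^sup>2 * norm (f z)) * \<Psi>1 s"
          using s by (intro orlicz_function_scale[OF \<Psi>1]) auto
        then show "ennreal (\<Psi>1 (norm (f z) / (1 / (h\<^sup>2 * s)))) \<le> ennreal (norm (f z))"
          using s h by (intro ennreal_leI) (simp add: mult_ac)
      qed
      with int show ?thesis by auto
    qed
    have f1: "f \<in> bergman_orlicz \<Psi>1"
      using hol int1 s h borel_measurable_unit_disk[OF holomorphic_on_imp_continuous_on[OF hol] sets_area_measure]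
      by (auto simp: bergman_orlicz_def orlicz_space_def intro!: exI[of _ "1 / (h\<^sup>2 * s)"])
    have lux1: "luxemburg_norm \<Psi>1 area_measure f \<le> 1 / (h\<^sup>2 * s)"
      using int1 h s by (intro luxemburg_norm_le) auto
    have lux1_nonneg: "0 \<le> luxemburg_norm \<Psi>1 area_measure f"
      unfolding luxemburg_norm_def
      using int1 h s by (intro cInf_greatest) (auto intro!: exI[of _ "1 / (h\<^sup>2 * s)"])
    have "luxemburg_norm \<Psi>2 \<mu> f \<le> N * (1 / (h\<^sup>2 * s))"
      using M[OF f1] lux1 lux1_nonneg N mult_mono[of M N "luxemburg_norm \<Psi>1 area_measure f" "1 / (h\<^sup>2 * s)"] by simp
    also have "\<dots> < 2 * N * (1 / (h\<^sup>2 * s))" using N h s by (intro mult_strict_right_mono) auto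
    finally have int2: "(\<integral>\<^sup>+z. ennreal (\<Psi>2 (norm (f z) / (2 * N * (1 / (h\<^sup>2 * s))))) \<partial>\<mu>) \<le> 1"
      using f1 sub by (intro nn_integral_le_one_of_luxemburg_norm_less[OF \<Psi>2]) auto
    have pos: "0 < \<Psi>2 (A * s)" using A s by (intro orlicz_function_pos[OF \<Psi>2]) simp
    \<comment> \<open>Chebyshev's inequality on the window, where \<open>norm (f z)\<close> divided
      by its norm bound is at least \<open>A * s\<close>.\<close>
    have "ennreal (\<Psi>2 (A * s)) * emeasure \<mu> (window \<xi> h)
        = (\<integral>\<^sup>+z. ennreal (\<Psi>2 (A * s)) * indicator (window \<xi> h) z \<partial>\<mu>)"
      by (rule nn_integral_cmult_indicator[symmetric, OF window_in_sets[OF sets]])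
    also have "\<dots> \<le> (\<integral>\<^sup>+z. ennreal (\<Psi>2 (norm (f z) / (2 * N * (1 / (h\<^sup>2 * s))))) \<partial>\<mu>)"
    proof (rule nn_integral_mono)
      fix z
      have "A * s \<le> norm (f z) / (2 * N * (1 / (h\<^sup>2 * s)))" if z: "z \<in> window \<xi> h"
      proof -
        have zD: "z \<in> unit_disk" using z by (simp add: window_def)
        have "norm (k z) ^ 4 \<le> (6 * h) ^ 4"
          using norm_kernel_le_on_window[OF \<xi> h z] by (intro power_mono) (auto simp: k_def)
        then have "1 / (6 * h) ^ 4 \<le> 1 / norm (k z) ^ 4"
          using h k0[OF zD] by (intro divide_left_mono mult_pos_pos) auto
        then have "h\<^sup>2 / 86 * (1 / (6 * h) ^ 4) * (h\<^sup>2 * s / (2 * N)) \<le> norm (f z) * (h\<^sup>2 * s / (2 * N))"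
          unfolding nf using N s by (intro mult_right_mono mult_left_mono) auto
        also have "h\<^sup>2 / 86 * (1 / (6 * h) ^ 4) * (h\<^sup>2 * s / (2 * N)) = A * s"
          using h N by (simp add: A_def field_simps power_mult_distrib eval_nat_numeral)
        finally show ?thesis by (simp add: field_simps)
      qed
      then show "ennreal (\<Psi>2 (A * s)) * indicator (window \<xi> h) z
          \<le> ennreal (\<Psi>2 (norm (f z) / (2 * N * (1 / (h\<^sup>2 * s)))))"
        using A s by (auto simp: indicator_def intro!: ennreal_leI orlicz_function_mono[OF \<Psi>2])
    qed
    finally have "ennreal (\<Psi>2 (A * s) * measure \<mu> (window \<xi> h)) \<le> 1"
      using int2 pos by (simp add: emeasure_eq_measure ennreal_mult)
    then show ?thesis
      using pos by (simp add: s_def field_simps)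
  qed
  then have "\<forall>h\<in>{0<..<1}. rho \<mu> h \<le> 1 / \<Psi>2 (A * orlicz_inv \<Psi>1 (1 / h^2))"
    unfolding rho_def by (intro ballI cSUP_least) auto
  with A show ?thesis by blast
qed

subsection \<open>Sufficiency: averaging over hyperbolic disks\<close>

lemma abs_arctan_le: "\<bar>arctan x\<bar> \<le> \<bar>x\<bar>"
proof -
  have "norm (arctan x - arctan 0) \<le> 1 * norm (x - 0)"
    by (rule field_differentiable_bound[where S=UNIV and f'="\<lambda>x. inverse (1 + x\<^sup>2)"])
       (auto intro!: DERIV_arctan simp: inverse_le_1_iff)
  then show ?thesis by simp
qed

text \<open>Closeness gives \<open>dist z w < 1 - norm w\<close> and
  \<open>1 - norm z < 2 * (1 - norm w)\<close>. After rotating \<open>w\<close> to the positive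
  axis, the argument of \<open>z\<close> is at most
  \<open>\<bar>Im \<zeta> / Re \<zeta>\<bar>\<close>, hence at most twice the distance.\<close>

lemma mem_window_of_close:
  assumes w: "norm w < 1" and d: "1 - norm z < 1 / 4" "norm z < 1"
    and close: "dist z w < (1 - norm z) / 2"
  shows "z \<in> window (sgn w) (2 * (1 - norm w))" and "w \<noteq> 0"
proof -
  have tri: "\<bar>norm z - norm w\<bar> \<le> dist z w"
    using norm_triangle_ineq3[of z w] by (simp add: dist_norm)
  show "w \<noteq> 0" using d close tri by auto
  define \<zeta> where "\<zeta> = z * cnj (sgn w)"
  have "w * cnj (sgn w) = of_real (norm w)"
    using complex_norm_square[of w] \<open>w \<noteq> 0\<close>
    by (simp add: sgn_div_norm scaleR_conv_of_real field_simps power2_eq_square)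
  then have "\<zeta> - of_real (norm w) = (z - w) * cnj (sgn w)"
    by (simp add: \<zeta>_def algebra_simps)
  then have nrm: "norm (\<zeta> - of_real (norm w)) = dist z w"
    using \<open>w \<noteq> 0\<close> by (simp add: norm_mult norm_sgn dist_norm)
  have Im: "\<bar>Im \<zeta>\<bar> \<le> dist z w"
    using abs_Im_le_cmod[of "\<zeta> - of_real (norm w)"] nrm by simp
  have "\<bar>Re \<zeta> - norm w\<bar> \<le> dist z w"
    using abs_Re_le_cmod[of "\<zeta> - of_real (norm w)"] nrm by simp
  \<comment> \<open>From \<open>norm z > 3 / 4\<close> and \<open>dist z w < 1 / 8\<close> follows
    \<open>norm w > 5 / 8\<close>, and another \<open>1 / 8\<close> is lost in the real
    part.\<close>
  then have Re: "1 / 2 \<le> Re \<zeta>"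
    using tri d close by (auto simp: abs_le_iff)
  have "\<bar>Arg \<zeta>\<bar> \<le> \<bar>Im \<zeta> / Re \<zeta>\<bar>"
    using Re abs_arctan_le[of "Im \<zeta> / Re \<zeta>"] by (simp add: arg_conv_arctan)
  also have "\<dots> \<le> dist z w / (1 / 2)"
    using Re Im unfolding abs_divide by (intro frac_le) auto
  also have "\<dots> \<le> 1 * (2 * (1 - norm w))"
    using close tri by simp
  also have "\<dots> \<le> pi * (2 * (1 - norm w))"
    using w pi_ge_two by (intro mult_right_mono) auto
  finally have "\<bar>Arg \<zeta>\<bar> \<le> pi * (2 * (1 - norm w))" .
  moreover have "1 - 2 * (1 - norm w) \<le> norm z"
    using close tri d by (auto simp: abs_le_iff)
  ultimately show "z \<in> window (sgn w) (2 * (1 - norm w))"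
    using d by (simp add: window_def unit_disk_def \<zeta>_def)
qed

text \<open>With \<open>x / 0 = \<infinity>\<close> in \<open>ennreal\<close>, division by this quantity needs no case distinction on
  whether \<open>\<mu>\<close> vanishes near the boundary.\<close>

definition window_ratio :: "complex measure \<Rightarrow> real \<Rightarrow> ennreal" where
  "window_ratio \<mu> h = (SUP t\<in>{0<..<h}. ennreal (rho \<mu> t / t\<^sup>2))"

lemma window_ratio_mono: "h \<le> h' \<Longrightarrow> window_ratio \<mu> h \<le> window_ratio \<mu> h'"
  unfolding window_ratio_def by (intro SUP_subset_mono) auto

text \<open>The supremum is uncountable, but each strict superlevel set is a union of open rays and
  hence open.\<close>

lemma borel_measurable_window_ratio [measurable]: "window_ratio \<mu> \<in> borel_measurable borel"
proof (rule borel_measurableI_greater)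
  fix y
  have "{h. y < window_ratio \<mu> h} = (\<Union>t\<in>{t. 0 < t \<and> y < ennreal (rho \<mu> t / t\<^sup>2)}. {t<..})"
    by (auto simp: window_ratio_def less_SUP_iff)
  then show "{h \<in> space borel. y < window_ratio \<mu> h} \<in> sets borel"
    by (simp, intro borel_open open_UN ballI open_greaterThan)
qed

lemma window_ratio_le:
  assumes "K_mu2 \<mu> h \<le> ereal c"
  shows "window_ratio \<mu> h \<le> ennreal c"
  unfolding window_ratio_def
proof (rule SUP_least)
  fix t assume "t \<in> {0<..<h}"
  then have "ereal (rho \<mu> t / t\<^sup>2) \<le> ereal c"
    using assms unfolding K_mu2_def SUP_le_iff by blast
  then show "ennreal (rho \<mu> t / t\<^sup>2) \<le> ennreal c"
    by (simp add: ennreal_leI)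
qed

text \<open>\<open>t < h\<close> is strict because the supremum in \<open>window_ratio\<close> runs
  over an open interval.\<close>

lemma emeasure_window_le:
  assumes fin: "finite_measure \<mu>" and \<xi>: "norm \<xi> = 1" and t: "0 < t" "t < h"
  shows "emeasure \<mu> (window \<xi> t) \<le> window_ratio \<mu> h * ennreal (t\<^sup>2)"
proof -
  interpret finite_measure \<mu> by fact
  have r: "measure \<mu> (window \<xi> t) \<le> rho \<mu> t"
    by (rule measure_window_le_rho[OF fin \<xi>])
  then have r0: "0 \<le> rho \<mu> t" by (rule order_trans[OF measure_nonneg])
  have "emeasure \<mu> (window \<xi> t) \<le> ennreal (rho \<mu> t)"
    using r by (simp add: emeasure_eq_measure ennreal_leI)
  also have "\<dots> = ennreal (rho \<mu> t / t\<^sup>2) * ennreal (t\<^sup>2)"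
    using t r0 by (simp flip: ennreal_mult)
  also have "\<dots> \<le> window_ratio \<mu> h * ennreal (t\<^sup>2)"
    unfolding window_ratio_def using t by (intro mult_right_mono SUP_upper) auto
  finally show ?thesis .
qed

lemma ennreal_inverse_antimono: "a \<le> b \<Longrightarrow> inverse b \<le> inverse (a :: ennreal)"
  including ennreal.lifting by transfer (rule ereal_inverse_antimono)

text \<open>For \<open>K = 0\<close> the quotient is infinite only if \<open>y \<noteq> 0\<close>,
  as \<open>0 / 0 = 0\<close> in \<open>ennreal\<close>; infinite \<open>K\<close> is excluded by
  the real bound.\<close>

lemma ennreal_le_divideI:
  assumes "0 < x" "0 \<le> y" "K \<le> ennreal (y / x)" "y \<noteq> 0"
  shows "ennreal x \<le> ennreal y / K"
proof (cases K)
  case (real k)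
  show ?thesis
  proof (cases "k = 0")
    case True
    then show ?thesis using assms real by simp
  next
    case False
    then have "x \<le> y / k"
      using assms real by (simp add: ennreal_le_iff field_simps)
    then show ?thesis
      using False assms real by (simp add: divide_ennreal ennreal_leI)
  qed
next
  case top
  then show ?thesis using assms by (simp add: top_unique)
qed

text \<open>Only an inequality: for \<open>K = 0\<close> and for infinite \<open>K\<close> the left
  side is \<open>0\<close>.\<close>

lemma ennreal_divide_mult_le: "c / K * (K * b) \<le> c * (b :: ennreal)"
proof (cases "K = 0 \<or> K = \<infinity>")
  case False
  then have "c / K * (K * b) = c * b"
    by (simp add: ennreal_divide_times less_top flip: mult.assoc)
  then show ?thesis by simp
qed (auto simp: top_unique)

text \<open>The averaging kernel of the sub-mean value property, weighted by \<open>1 / window_ratio\<close>, is integrated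
  in \<open>z\<close> first: all \<open>z\<close> seeing a given \<open>w\<close> lie in one window of size \<open>2 * (1 - norm w)\<close>.\<close>

definition kernel_weight :: "complex measure \<Rightarrow> complex \<Rightarrow> ennreal" where
  "kernel_weight \<mu> z = (if norm z < 1 \<and> 4 * (1 - norm z) < 1
     then ennreal (4 / (pi * (1 - norm z)\<^sup>2)) / window_ratio \<mu> (4 * (1 - norm z)) else 0)"

lemma borel_measurable_kernel_weight [measurable]: "kernel_weight \<mu> \<in> borel_measurable borel"
  unfolding kernel_weight_def by measurable

lemma nn_integral_kernel_weight_le:
  assumes fin: "finite_measure \<mu>" and sets: "sets \<mu> = sets (restrict_space borel unit_disk)"
    and w: "norm w < 1"
  shows "(\<integral>\<^sup>+z. kernel_weight \<mu> z * of_bool (dist z w < (1 - norm z) / 2) \<partial>\<mu>) \<le> ennreal (36 / pi)"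
proof (cases "w = 0")
  case True
  \<comment> \<open>The origin has no direction \<open>sgn w\<close> on the circle, but the weight
    is supported near the boundary, where no \<open>z\<close> is close enough to see it.\<close>
  have "kernel_weight \<mu> z * of_bool (dist z w < (1 - norm z) / 2) = 0" for z
    using True mem_window_of_close(2)[OF w, of z] by (auto simp: kernel_weight_def)
  then show ?thesis by (simp only: nn_integral_const) simp
next
  case False
  define \<delta> where "\<delta> = 1 - norm w"
  have \<delta>: "0 < \<delta>" using w by (simp add: \<delta>_def)
  \<comment> \<open>Every \<open>z\<close> that sees \<open>w\<close> satisfies
    \<open>1 - norm z \<ge> 2 / 3 * \<delta>\<close>. This gives \<open>8 / 3 = 4 * (2 / 3)\<close>
    here and \<open>9 = 4 / (2 / 3)\<^sup>2\<close> below; also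
    \<open>2 * \<delta> < 8 / 3 * \<delta>\<close>, as \<open>emeasure_window_le\<close>
    requires.\<close>
  let ?K = "window_ratio \<mu> (8 / 3 * \<delta>)"
  have "(\<integral>\<^sup>+z. kernel_weight \<mu> z * of_bool (dist z w < (1 - norm z) / 2) \<partial>\<mu>)
      \<le> (\<integral>\<^sup>+z. ennreal (9 / (pi * \<delta>\<^sup>2)) / ?K * indicator (window (sgn w) (2 * \<delta>)) z \<partial>\<mu>)"
  proof (rule nn_integral_mono)
    fix z
    show "kernel_weight \<mu> z * of_bool (dist z w < (1 - norm z) / 2)
        \<le> ennreal (9 / (pi * \<delta>\<^sup>2)) / ?K * indicator (window (sgn w) (2 * \<delta>)) z"
    proof (cases "norm z < 1 \<and> 4 * (1 - norm z) < 1 \<and> dist z w < (1 - norm z) / 2")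
      case True
      then have win: "z \<in> window (sgn w) (2 * \<delta>)"
        using mem_window_of_close(1)[OF w, of z] by (simp add: \<delta>_def)
      have "\<bar>norm z - norm w\<bar> \<le> dist z w"
        using norm_triangle_ineq3[of z w] by (simp add: dist_norm)
      then have d: "2 / 3 * \<delta> \<le> 1 - norm z" using True by (auto simp: \<delta>_def)
      have "4 / (pi * (1 - norm z)\<^sup>2) \<le> 4 / (pi * (2 / 3 * \<delta>)\<^sup>2)"
        using d \<delta> True by (intro divide_left_mono mult_left_mono power_mono mult_pos_pos zero_less_power) auto
      also have "\<dots> = 9 / (pi * \<delta>\<^sup>2)" using \<delta> by (simp add: field_simps)
      finally have 1: "4 / (pi * (1 - norm z)\<^sup>2) \<le> 9 / (pi * \<delta>\<^sup>2)" .
      have "?K \<le> window_ratio \<mu> (4 * (1 - norm z))"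
        using d by (intro window_ratio_mono) simp
      then have "inverse (window_ratio \<mu> (4 * (1 - norm z))) \<le> inverse ?K"
        by (rule ennreal_inverse_antimono)
      with 1 have "kernel_weight \<mu> z \<le> ennreal (9 / (pi * \<delta>\<^sup>2)) / ?K"
        using True by (auto simp: kernel_weight_def divide_ennreal_def intro!: mult_mono ennreal_leI)
      then show ?thesis using win True by simp
    qed (auto simp: kernel_weight_def)
  qed
  also have "\<dots> = ennreal (9 / (pi * \<delta>\<^sup>2)) / ?K * emeasure \<mu> (window (sgn w) (2 * \<delta>))"
    by (rule nn_integral_cmult_indicator[OF window_in_sets[OF sets]])
  also have "\<dots> \<le> ennreal (9 / (pi * \<delta>\<^sup>2)) / ?K * (?K * ennreal ((2 * \<delta>)\<^sup>2))"
    using False \<delta> by (intro mult_left_mono emeasure_window_le[OF fin]) (auto simp: norm_sgn)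
  also have "\<dots> \<le> ennreal (9 / (pi * \<delta>\<^sup>2)) * ennreal ((2 * \<delta>)\<^sup>2)"
    by (rule ennreal_divide_mult_le)
  also have "\<dots> = ennreal (36 / pi)"
    using \<delta> by (simp add: field_simps flip: ennreal_mult)
  finally show ?thesis .
qed

text \<open>The first summand covers the points with \<open>u z \<le> 1\<close>, for which no
  \<open>h < 1\<close> with \<open>1 / h\<^sup>2 = u z\<close> exists. The constant
  \<open>64\<close> serves twice: it makes \<open>u_le\<close> hold with the factor
  \<open>4\<close>, and it brings the averaged part down to \<open>36 / 64 \<le> 1\<close>.\<close>

lemma nn_integral_orlicz_le:
  fixes \<mu> :: "complex measure" and g :: "complex \<Rightarrow> complex"
  assumes fin: "finite_measure \<mu>" and sets: "sets \<mu> = sets (restrict_space borel unit_disk)"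
    and \<Psi>1: "orlicz_function \<Psi>1" and \<Psi>2: "orlicz_function \<Psi>2" and A: "0 < A"
    and K: "\<And>h. 0 < h \<Longrightarrow> h < 1 \<Longrightarrow> K_mu2 \<mu> h \<le> ereal ((1 / h^2) / \<Psi>2 (A * orlicz_inv \<Psi>1 (1 / h^2)))"
    and g: "g holomorphic_on unit_disk"
    and int: "(\<integral>\<^sup>+z. ennreal (\<Psi>1 (norm (g z))) \<partial>area_measure) \<le> 1"
  shows "(\<integral>\<^sup>+z. ennreal (\<Psi>2 (A * norm (g z) / 64)) \<partial>\<mu>)
    \<le> ennreal (\<Psi>2 (A * orlicz_inv \<Psi>1 1)) * emeasure \<mu> (space \<mu>) + 1"
proof -
  interpret finite_measure \<mu> by fact
  interpret P: pair_sigma_finite \<mu> "lborel :: complex measure" ..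
  have D: "unit_disk \<in> sets borel" by (simp add: unit_disk_def)
  have sp: "space \<mu> = unit_disk"
    using sets_eq_imp_space_eq[OF sets] by (simp add: space_restrict_space)
  note id_meas = measurable_ident_unit_disk[OF sets]
  define u where "u z = \<Psi>1 (norm (g z / 64))" for z
  \<comment> \<open>Extension by zero, so that the averages and Fubini's theorem can use Lebesgue
    measure on the whole plane.\<close>
  define v where "v w = ennreal (u w) * indicator unit_disk w" for w
  have u0: "0 \<le> u z" for z by (simp add: u_def orlicz_function_nonneg[OF \<Psi>1])
  have g64: "(\<lambda>z. g z / 64) holomorphic_on unit_disk"
    using g by (intro holomorphic_intros) auto
  have cg: "continuous_on unit_disk (\<lambda>z. norm (g z))"
    by (intro continuous_intros holomorphic_on_imp_continuous_on g)
  have cu: "continuous_on unit_disk u"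
    unfolding u_def
    by (rule continuous_on_compose2[OF orlicz_function_continuous_on[OF \<Psi>1]
        continuous_on_norm[OF holomorphic_on_imp_continuous_on[OF g64]]]) auto
  have um [measurable]: "(\<lambda>z. ennreal (u z)) \<in> borel_measurable (restrict_space borel unit_disk)"
    by (intro measurable_compose[OF borel_measurable_unit_disk[OF cu refl]]) simp
  have vm [measurable]: "v \<in> borel_measurable borel"
    using um D unfolding v_def by (simp add: borel_measurable_restrict_space_iff_ennreal)
  have int_u: "(\<integral>\<^sup>+z. ennreal (u z) \<partial>area_measure) \<le> ennreal (1 / 64)"
  proof -
    have gm: "(\<lambda>z. ennreal (\<Psi>1 (norm (g z)))) \<in> borel_measurable area_measure"
      using borel_measurable_orlicz_function[OF \<Psi>1 borel_measurable_unit_disk[OF cg sets_area_measure]]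
      by simp
    have "(\<integral>\<^sup>+z. ennreal (u z) \<partial>area_measure) \<le> (\<integral>\<^sup>+z. ennreal (1 / 64) * ennreal (\<Psi>1 (norm (g z))) \<partial>area_measure)"
    proof (rule nn_integral_mono)
      fix z
      show "ennreal (u z) \<le> ennreal (1 / 64) * ennreal (\<Psi>1 (norm (g z)))"
        using orlicz_function_scale[OF \<Psi>1, of "1 / 64" "norm (g z)"] orlicz_function_nonneg[OF \<Psi>1]
        by (subst ennreal_mult[symmetric]) (auto simp: u_def norm_divide intro!: ennreal_leI)
    qed
    also have "\<dots> = ennreal (1 / 64) * (\<integral>\<^sup>+z. ennreal (\<Psi>1 (norm (g z))) \<partial>area_measure)"
      by (rule nn_integral_cmult[OF gm])
    also have "\<dots> \<le> ennreal (1 / 64) * 1" by (intro mult_left_mono int) simp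
    finally show ?thesis by simp
  qed
  have int_v: "(\<integral>\<^sup>+w. v w \<partial>lborel) \<le> ennreal (pi / 64)"
  proof -
    have "(\<integral>\<^sup>+w. v w \<partial>lborel) = ennreal pi * (ennreal (1 / pi) * (\<integral>\<^sup>+w. v w \<partial>lborel))"
      by (simp add: mult.assoc[symmetric] flip: ennreal_mult)
    also have "\<dots> = ennreal pi * (\<integral>\<^sup>+z. ennreal (u z) \<partial>area_measure)"
      unfolding nn_integral_area_measure[OF um] v_def ..
    also have "\<dots> \<le> ennreal pi * ennreal (1 / 64)" by (intro mult_left_mono int_u) simp
    also have "\<dots> = ennreal (pi / 64)" by (simp flip: ennreal_mult)
    finally show ?thesis .
  qed
  have mean: "ennreal (u z) \<le> ennreal (4 / (pi * (1 - norm z)\<^sup>2))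
      * (\<integral>\<^sup>+w. v w * of_bool (dist z w < (1 - norm z) / 2) \<partial>lborel)" if z: "norm z < 1" for z
  proof -
    define r where "r = (1 - norm z) / 2"
    have r: "0 < r" using z by (simp add: r_def)
    have sub: "ball z r \<subseteq> unit_disk"
    proof
      fix w assume "w \<in> ball z r"
      then show "w \<in> unit_disk"
        using norm_triangle_sub[of w z] z by (auto simp: r_def unit_disk_def dist_norm norm_minus_commute field_simps)
    qed
    have "ennreal (u z) = ennreal (1 / (pi * r\<^sup>2)) * (ennreal (u z) * ennreal (pi * r\<^sup>2))"
      using r u0 by (simp flip: ennreal_mult)
    also have "ennreal (pi * r\<^sup>2) = emeasure lborel (ball z r)"
      using r by (simp add: emeasure_ball unit_ball_vol_2)
    also have "ennreal (u z) * emeasure lborel (ball z r) \<le> (\<integral>\<^sup>+w. ennreal (u w) * indicator (ball z r) w \<partial>lborel)"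
      unfolding u_def
      by (rule orlicz_function_area_mean_le[OF \<Psi>1 holomorphic_on_subset[OF g64 sub]])
    also have "\<dots> = (\<integral>\<^sup>+w. v w * of_bool (dist z w < (1 - norm z) / 2) \<partial>lborel)"
      using sub by (intro nn_integral_cong) (auto simp: v_def indicator_def r_def)
    finally show ?thesis
      by (simp add: r_def power_divide mult_left_mono)
  qed
  have u_le: "u z \<le> 1 / (4 * (1 - norm z))\<^sup>2" if z: "norm z < 1" for z
  proof -
    have "ennreal (u z) \<le> ennreal (4 / (pi * (1 - norm z)\<^sup>2)) * (\<integral>\<^sup>+w. v w \<partial>lborel)"
      by (rule order_trans[OF mean[OF z]]) (intro mult_left_mono nn_integral_mono, auto)
    also have "\<dots> \<le> ennreal (4 / (pi * (1 - norm z)\<^sup>2)) * ennreal (pi / 64)"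
      by (intro mult_left_mono int_v) simp
    also have "\<dots> = ennreal (1 / (4 * (1 - norm z))\<^sup>2)"
      unfolding power_mult_distrib by (simp flip: ennreal_mult)
    finally show ?thesis by (subst (asm) ennreal_le_iff) auto
  qed
  let ?C = "ennreal (\<Psi>2 (A * orlicz_inv \<Psi>1 1))"
  let ?k = "\<lambda>z w. kernel_weight \<mu> z * (v w * of_bool (dist z w < (1 - norm z) / 2))"
  \<comment> \<open>\<open>\<mu>\<close> carries only the Borel sets of the disk; joint
    measurability is pulled back from the plane along the inclusion.\<close>
  have k_meas: "(\<lambda>(z, w). ?k z w) \<in> borel_measurable (\<mu> \<Otimes>\<^sub>M lborel)"
  proof -
    have "(\<lambda>(z, w). ?k z w) \<in> borel_measurable (borel \<Otimes>\<^sub>M borel)" by measurable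
    moreover have "(\<lambda>p. (fst p, snd p)) \<in> \<mu> \<Otimes>\<^sub>M lborel \<rightarrow>\<^sub>M borel \<Otimes>\<^sub>M (borel :: complex measure)"
      by (intro measurable_Pair measurable_compose[OF measurable_fst id_meas]) simp
    ultimately show ?thesis by (simp add: measurable_compose)
  qed
  have pointwise: "ennreal (\<Psi>2 (A * norm (g z) / 64)) \<le> ?C + (\<integral>\<^sup>+w. ?k z w \<partial>lborel)"
    if z: "norm z < 1" for z
  proof (cases "u z \<le> 1")
    case True
    have "norm (g z) / 64 \<le> orlicz_inv \<Psi>1 1"
      using orlicz_function_strict_mono[OF \<Psi>1 orlicz_inv_nonneg[OF \<Psi>1], of 1 "norm (g z) / 64"]
        orlicz_function_inv[OF \<Psi>1, of 1] True
      by (force simp: u_def norm_divide)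
    then have "A * norm (g z) / 64 \<le> A * orlicz_inv \<Psi>1 1"
      using A mult_left_mono[of "norm (g z) / 64" "orlicz_inv \<Psi>1 1" A] by simp
    then have "ennreal (\<Psi>2 (A * norm (g z) / 64)) \<le> ?C"
      using A by (intro ennreal_leI orlicz_function_mono[OF \<Psi>2]) auto
    then show ?thesis by (rule order_trans) simp
  next
    case False
    define d where "d = 1 - norm z"
    \<comment> \<open>With \<open>1 / h\<^sup>2 = u z\<close> the inverse in \<open>K\<close> is
      exactly \<open>norm (g z) / 64\<close>. The bound \<open>u_le\<close> becomes
      \<open>4 * d \<le> h\<close>, which transfers the hypothesis from \<open>h\<close> down to
      \<open>4 * d\<close> and also puts \<open>z\<close> in the support of
      \<open>kernel_weight\<close>.\<close>
    define h where "h = 1 / sqrt (u z)"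
    have d: "0 < d" using z by (simp add: d_def)
    have h: "0 < h" "h < 1" "1 / h\<^sup>2 = u z" using False by (auto simp: h_def power_divide)
    have "u z * (4 * d)\<^sup>2 \<le> 1"
      using u_le[OF z] d pos_le_divide_eq[of "(4 * d)\<^sup>2" "u z" 1] by (simp add: d_def)
    then have "(4 * d)\<^sup>2 \<le> 1 / u z"
      using False pos_le_divide_eq[of "u z" "(4 * d)\<^sup>2" 1] by (simp add: mult.commute)
    then have "(4 * d)\<^sup>2 \<le> h\<^sup>2" using False by (simp add: h_def power_divide)
    then have dh: "4 * d \<le> h" by (rule power2_le_imp_le) (use h in auto)
    have inv: "orlicz_inv \<Psi>1 (u z) = norm (g z) / 64"
      using orlicz_inv_eqI[OF \<Psi>1, of "norm (g z / 64)"] by (simp add: u_def norm_divide)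
    have "0 < norm (g z)"
      using False orlicz_function_zero[OF \<Psi>1] by (cases "g z = 0") (auto simp: u_def)
    then have pos: "0 < \<Psi>2 (A * norm (g z) / 64)"
      using A by (intro orlicz_function_pos[OF \<Psi>2]) simp
    have "window_ratio \<mu> (4 * d) \<le> window_ratio \<mu> h" by (rule window_ratio_mono[OF dh])
    also have "\<dots> \<le> ennreal (u z / \<Psi>2 (A * norm (g z) / 64))"
      using window_ratio_le[OF K[OF h(1,2)]] by (simp add: h(3) inv)
    finally have "ennreal (\<Psi>2 (A * norm (g z) / 64)) \<le> ennreal (u z) / window_ratio \<mu> (4 * d)"
      using pos False by (intro ennreal_le_divideI) auto
    also have "\<dots> \<le> ennreal (4 / (pi * d\<^sup>2)) * (\<integral>\<^sup>+w. v w * of_bool (dist z w < (1 - norm z) / 2) \<partial>lborel)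
        / window_ratio \<mu> (4 * d)"
      using mean[OF z] by (intro divide_right_mono_ennreal) (simp add: d_def)
    also have "\<dots> = kernel_weight \<mu> z * (\<integral>\<^sup>+w. v w * of_bool (dist z w < (1 - norm z) / 2) \<partial>lborel)"
      using z dh h by (simp add: kernel_weight_def d_def divide_ennreal_def mult_ac)
    also have "\<dots> = (\<integral>\<^sup>+w. ?k z w \<partial>lborel)"
      by (rule nn_integral_cmult[symmetric]) measurable
    finally show ?thesis by (rule order_trans) simp
  qed
  have "(\<integral>\<^sup>+z. ennreal (\<Psi>2 (A * norm (g z) / 64)) \<partial>\<mu>) \<le> (\<integral>\<^sup>+z. ?C + (\<integral>\<^sup>+w. ?k z w \<partial>lborel) \<partial>\<mu>)"
    using pointwise by (intro nn_integral_mono) (simp add: sp unit_disk_def)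
  also have "\<dots> = ?C * emeasure \<mu> (space \<mu>) + (\<integral>\<^sup>+z. (\<integral>\<^sup>+w. ?k z w \<partial>lborel) \<partial>\<mu>)"
    using lborel.borel_measurable_nn_integral[OF k_meas] by (subst nn_integral_add) simp_all
  also have "(\<integral>\<^sup>+z. (\<integral>\<^sup>+w. ?k z w \<partial>lborel) \<partial>\<mu>) = (\<integral>\<^sup>+w. (\<integral>\<^sup>+z. ?k z w \<partial>\<mu>) \<partial>lborel)"
    by (rule P.Fubini'[OF k_meas, symmetric])
  also have "\<dots> \<le> (\<integral>\<^sup>+w. ennreal (36 / pi) * v w \<partial>lborel)"
  proof (rule nn_integral_mono)
    fix w
    have "(\<integral>\<^sup>+z. ?k z w \<partial>\<mu>) = v w * (\<integral>\<^sup>+z. kernel_weight \<mu> z * of_bool (dist z w < (1 - norm z) / 2) \<partial>\<mu>)"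
    proof (subst nn_integral_cmult[symmetric])
      show "(\<lambda>z. kernel_weight \<mu> z * of_bool (dist z w < (1 - norm z) / 2)) \<in> borel_measurable \<mu>"
        by (rule measurable_compose[OF id_meas]) measurable
    qed (simp add: mult_ac)
    also have "\<dots> \<le> v w * ennreal (36 / pi)"
    proof (cases "norm w < 1")
      case True
      then show ?thesis by (intro mult_left_mono nn_integral_kernel_weight_le fin sets) auto
    qed (simp add: v_def unit_disk_def)
    finally show "(\<integral>\<^sup>+z. ?k z w \<partial>\<mu>) \<le> ennreal (36 / pi) * v w" by (simp add: mult.commute)
  qed
  also have "\<dots> = ennreal (36 / pi) * (\<integral>\<^sup>+w. v w \<partial>lborel)"
    by (rule nn_integral_cmult) simp
  also have "\<dots> \<le> ennreal (36 / pi) * ennreal (pi / 64)" by (intro mult_left_mono int_v) simp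
  also have "\<dots> \<le> 1" by (simp flip: ennreal_mult)
  finally show ?thesis by (simp add: add_left_mono)
qed

text \<open>The integral estimate yields a constant \<open>c \<ge> 1\<close> instead of
  \<open>1\<close>; scaling the argument by \<open>1 / c\<close> repairs this by convexity, and
  \<open>M\<close> collects \<open>c\<close>, \<open>64\<close> and \<open>A\<close>.\<close>

lemma embedding_boundedI:
  fixes \<mu> :: "complex measure"
  assumes fin: "finite_measure \<mu>" and sets: "sets \<mu> = sets (restrict_space borel unit_disk)"
    and \<Psi>1: "orlicz_function \<Psi>1" and \<Psi>2: "orlicz_function \<Psi>2" and A: "0 < A"
    and K: "\<And>h. 0 < h \<Longrightarrow> h < 1 \<Longrightarrow> K_mu2 \<mu> h \<le> ereal ((1 / h^2) / \<Psi>2 (A * orlicz_inv \<Psi>1 (1 / h^2)))"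
  shows "embedding_bounded \<Psi>1 \<Psi>2 \<mu>"
proof -
  interpret finite_measure \<mu> by fact
  define c where "c = \<Psi>2 (A * orlicz_inv \<Psi>1 1) * measure \<mu> (space \<mu>) + 1"
  define M where "M = 64 * c / A"
  have \<Psi>2_nonneg: "0 \<le> \<Psi>2 (A * orlicz_inv \<Psi>1 1)"
    using A orlicz_inv_nonneg[OF \<Psi>1, of 1] by (intro orlicz_function_nonneg[OF \<Psi>2]) simp
  then have c: "1 \<le> c" by (simp add: c_def)
  have M: "0 < M" using c A by (simp add: M_def)
  have bound: "(\<integral>\<^sup>+z. ennreal (\<Psi>2 (norm (f z) / (M * C))) \<partial>\<mu>) \<le> 1"
    if f: "f holomorphic_on unit_disk" and C: "0 < C"
      and int: "(\<integral>\<^sup>+z. ennreal (\<Psi>1 (norm (f z) / C)) \<partial>area_measure) \<le> 1" for f C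
  proof -
    define g where "g z = f z / of_real C" for z
    have ng: "norm (g z) = norm (f z) / C" for z using C by (simp add: g_def norm_divide)
    have g: "g holomorphic_on unit_disk"
      unfolding g_def using f C by (intro holomorphic_intros) auto
    have gm: "(\<lambda>z. ennreal (\<Psi>2 (A * norm (g z) / 64))) \<in> borel_measurable \<mu>"
      using A by (intro measurable_compose[OF borel_measurable_orlicz_function[OF \<Psi>2
            borel_measurable_unit_disk[OF _ sets]]] continuous_intros holomorphic_on_imp_continuous_on g) auto
    have "(\<integral>\<^sup>+z. ennreal (\<Psi>2 (norm (f z) / (M * C))) \<partial>\<mu>)
        \<le> (\<integral>\<^sup>+z. ennreal (1 / c) * ennreal (\<Psi>2 (A * norm (g z) / 64)) \<partial>\<mu>)"
    proof (rule nn_integral_mono)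
      fix z
      have "norm (f z) / (M * C) = 1 / c * (A * norm (g z) / 64)"
        using A C c by (simp add: ng M_def field_simps)
      then have "\<Psi>2 (norm (f z) / (M * C)) \<le> 1 / c * \<Psi>2 (A * norm (g z) / 64)"
        using A c by (simp only:) (intro orlicz_function_scale[OF \<Psi>2], auto)
      then show "ennreal (\<Psi>2 (norm (f z) / (M * C))) \<le> ennreal (1 / c) * ennreal (\<Psi>2 (A * norm (g z) / 64))"
        using A c orlicz_function_nonneg[OF \<Psi>2] by (subst ennreal_mult[symmetric]) (auto intro: ennreal_leI)
    qed
    also have "\<dots> = ennreal (1 / c) * (\<integral>\<^sup>+z. ennreal (\<Psi>2 (A * norm (g z) / 64)) \<partial>\<mu>)"
      by (rule nn_integral_cmult[OF gm])
    also have "\<dots> \<le> ennreal (1 / c) * (ennreal (\<Psi>2 (A * orlicz_inv \<Psi>1 1)) * emeasure \<mu> (space \<mu>) + 1)"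
      using int by (intro mult_left_mono nn_integral_orlicz_le[OF fin sets \<Psi>1 \<Psi>2 A K g]) (auto simp: ng)
    also have "\<dots> = ennreal (1 / c) * ennreal c"
      using \<Psi>2_nonneg by (simp add: c_def emeasure_eq_measure ennreal_mult)
    also have "\<dots> = 1" using c by (simp flip: ennreal_mult)
    finally show ?thesis .
  qed
  have "bergman_orlicz \<Psi>1 \<subseteq> orlicz_space \<Psi>2 \<mu>"
  proof
    fix f assume "f \<in> bergman_orlicz \<Psi>1"
    then obtain C where f: "f holomorphic_on unit_disk" and C: "0 < C"
      "(\<integral>\<^sup>+z. ennreal (\<Psi>1 (norm (f z) / C)) \<partial>area_measure) \<le> 1"
      by (auto simp: bergman_orlicz_def orlicz_space_def)
    have "f \<in> borel_measurable \<mu>"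
      by (rule borel_measurable_unit_disk[OF holomorphic_on_imp_continuous_on[OF f] sets])
    then show "f \<in> orlicz_space \<Psi>2 \<mu>"
      using bound[OF f C] M C by (auto simp: orlicz_space_def intro!: exI[of _ "M * C"])
  qed
  moreover have "luxemburg_norm \<Psi>2 \<mu> f \<le> M * luxemburg_norm \<Psi>1 area_measure f"
    if "f \<in> bergman_orlicz \<Psi>1" for f
  proof -
    have f: "f holomorphic_on unit_disk" using that by (simp add: bergman_orlicz_def)
    have "luxemburg_norm \<Psi>2 \<mu> f / M \<le> luxemburg_norm \<Psi>1 area_measure f"
      unfolding luxemburg_norm_def[of \<Psi>1]
    \<comment> \<open>Since \<open>bound\<close> holds for every admissible \<open>C\<close>, the
      infimum may be taken afterwards; the set is nonempty because \<open>f\<close> lies in the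
      space.\<close>
    proof (rule cInf_greatest)
      fix C assume "C \<in> {C. 0 < C \<and> (\<integral>\<^sup>+z. ennreal (\<Psi>1 (norm (f z) / C)) \<partial>area_measure) \<le> 1}"
      then show "luxemburg_norm \<Psi>2 \<mu> f / M \<le> C"
        using luxemburg_norm_le[where C="M * C" and \<Psi>=\<Psi>2 and f=f and M=\<mu>] bound[OF f, of C] M by (auto simp: field_simps)
    qed (use that in \<open>auto simp: bergman_orlicz_def orlicz_space_def\<close>)
    then show ?thesis using M by (simp add: field_simps)
  qed
  ultimately show ?thesis by (auto simp: embedding_bounded_def)
qed

theorem theorem2p1:
  fixes \<mu> :: "complex measure" and \<Psi>1 \<Psi>2 :: "real \<Rightarrow> real"
  assumes "finite_measure \<mu>"
    and "sets \<mu> = sets (restrict_space borel unit_disk)"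
    and "orlicz_function \<Psi>1" and "orlicz_function \<Psi>2"
  shows "(embedding_bounded \<Psi>1 \<Psi>2 \<mu> \<longrightarrow>
            (\<exists>A>0. \<forall>h\<in>{0<..<1}.
               rho \<mu> h \<le> 1 / \<Psi>2 (A * orlicz_inv \<Psi>1 (1 / h^2))))
       \<and> ((\<exists>A>0. \<forall>h\<in>{0<..<1}.
               K_mu2 \<mu> h \<le> ereal ((1 / h^2) / \<Psi>2 (A * orlicz_inv \<Psi>1 (1 / h^2))))
            \<longrightarrow> embedding_bounded \<Psi>1 \<Psi>2 \<mu>)"
  using embedding_bounded_imp_rho_le[OF assms] embedding_boundedI[OF assms] by auto

end
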